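(* Let $\mathbb M^1\subset\mathbb C^{1+8}$ be the rigid real analytic CR-generic submanifold given in coordinates $(z,w^1,\dots,w^8)$ by $$w^1-\overline w^1=2i\,z\overline z,\quad w^2-\overline w^2=2i(z^2\overline z+z\overline z^2),\quad w^3-\overline w^3=2(z^2\overline z-z\overline z^2),\quad w^4-\overline w^4=2i(z^3\overline z+z\overline z^3),$$ $$w^5-\overline w^5=2(z^3\overline z-z\overline z^3),\quad w^6-\overline w^6=2i\,z^2\overline z^2,\quad w^7-\overline w^7=2i(z^4\overline z+z\overline z^4),\quad w^8-\overline w^8=2(z^4\overline z-z\overline z^4).$$ The Lie algebra of infinitesimal CR-automorphisms $\mathfrak{aut}_{CR}(\mathbb M^1)$ is $12$-dimensional, generated by the twelve $\mathbb R$-linearly independent holomorphic vector fields $\mathsf X_i=\partial_{w^i}$, $i=1,\dots,8$, and $$\mathsf X_9=z\partial_z+2w^1\partial_{w^1}+3w^2\partial_{w^2}+3w^3\partial_{w^3}+4w^4\partial_{w^4}+4w^5\partial_{w^5}+4w^6\partial_{w^6}+5w^7\partial_{w^7}+5w^8\partial_{w^8},$$ $$\mathsf X_{10}=iz\partial_z-w^3\partial_{w^2}+w^2\partial_{w^3}-2w^5\partial_{w^4}+2w^4\partial_{w^5}-3w^8\partial_{w^7}+3w^7\partial_{w^8},$$ $$\mathsf X_{11}=\partial_z+2iz\partial_{w^1}+(4w^1+2iz^2)\partial_{w^2}+2z^2\partial_{w^3}+(3w^2+2iz^3)\partial_{w^4}+(3w^3+2z^3)\partial_{w^5}+2w^2\partial_{w^6}+(4w^4+2iz^4)\partial_{w^7}+(4w^5+2z^4)\partial_{w^8},$$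 $$\mathsf X_{12}=i\partial_z+2z\partial_{w^1}+2z^2\partial_{w^2}+(4w^1-2iz^2)\partial_{w^3}+(-3w^3+2z^3)\partial_{w^4}+(3w^2-2iz^3)\partial_{w^5}+2w^3\partial_{w^6}+(-4w^5+2z^4)\partial_{w^7}+(4w^4-2iz^4)\partial_{w^8}.$$ Furthermore, it is graded of the form $\mathfrak{aut}_{CR}(\mathbb M^1)=\mathfrak g_{-5}\oplus\mathfrak g_{-4}\oplus\mathfrak g_{-3}\oplus\mathfrak g_{-2}\oplus\mathfrak g_{-1}\oplus\mathfrak g_0$ with $\mathfrak g_{-5}=\langle\mathsf X_7,\mathsf X_8\rangle$, $\mathfrak g_{-4}=\langle\mathsf X_4,\mathsf X_5,\mathsf X_6\rangle$, $\mathfrak g_{-3}=\langle\mathsf X_2,\mathsf X_3\rangle$, $\mathfrak g_{-2}=\langle\mathsf X_1\rangle$, $\mathfrak g_{-1}=\langle\mathsf X_{11},\mathsf X_{12}\rangle$, $\mathfrak g_0=\langle\mathsf X_9,\mathsf X_{10}\rangle$, and with the following commutators: $[\mathsf X_i,\mathsf X_j]=0$ for $1\le i,j\le8$; $[\mathsf X_1,\mathsf X_9]=2\mathsf X_1$, $[\mathsf X_1,\mathsf X_{10}]=0$, $[\mathsf X_1,\mathsf X_{11}]=4\mathsf X_2$, $[\mathsf X_1,\mathsf X_{12}]=4\mathsf X_3$; $[\mathsf X_2,\mathsf X_9]=3\mathsf X_2$, $[\mathsf X_2,\mathsf X_{10}]=\mathsf X_3$, $[\mathsf X_2,\mathsf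 X_{11}]=3\mathsf X_4+2\mathsf X_6$, $[\mathsf X_2,\mathsf X_{12}]=3\mathsf X_5$; $[\mathsf X_3,\mathsf X_9]=3\mathsf X_3$, $[\mathsf X_3,\mathsf X_{10}]=-\mathsf X_2$, $[\mathsf X_3,\mathsf X_{11}]=3\mathsf X_5$, $[\mathsf X_3,\mathsf X_{12}]=-3\mathsf X_4+2\mathsf X_6$; $[\mathsf X_4,\mathsf X_9]=4\mathsf X_4$, $[\mathsf X_4,\mathsf X_{10}]=2\mathsf X_5$, $[\mathsf X_4,\mathsf X_{11}]=4\mathsf X_7$, $[\mathsf X_4,\mathsf X_{12}]=4\mathsf X_8$; $[\mathsf X_5,\mathsf X_9]=4\mathsf X_5$, $[\mathsf X_5,\mathsf X_{10}]=-2\mathsf X_4$, $[\mathsf X_5,\mathsf X_{11}]=4\mathsf X_8$, $[\mathsf X_5,\mathsf X_{12}]=-4\mathsf X_7$; $[\mathsf X_6,\mathsf X_9]=4\mathsf X_6$, $[\mathsf X_6,\mathsf X_{10}]=[\mathsf X_6,\mathsf X_{11}]=[\mathsf X_6,\mathsf X_{12}]=0$; $[\mathsf X_7,\mathsf X_9]=5\mathsf X_7$, $[\mathsf X_7,\mathsf X_{10}]=3\mathsf X_8$, $[\mathsf X_7,\mathsf X_{11}]=[\mathsf X_7,\mathsf X_{12}]=0$; $[\mathsf X_8,\mathsf X_9]=5\mathsf X_8$, $[\mathsf X_8,\mathsf X_{10}]=-3\mathsf X_7$, $[\mathsf X_8,\mathsf X_{11}]=[\mathsf X_8,\mathsf X_{12}]=0$;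 $[\mathsf X_9,\mathsf X_{10}]=0$, $[\mathsf X_9,\mathsf X_{11}]=-\mathsf X_{11}$, $[\mathsf X_9,\mathsf X_{12}]=-\mathsf X_{12}$, $[\mathsf X_{10},\mathsf X_{11}]=-\mathsf X_{12}$, $[\mathsf X_{10},\mathsf X_{12}]=\mathsf X_{11}$, $[\mathsf X_{11},\mathsf X_{12}]=4\mathsf X_1$.
   Context: For a real analytic CR-generic submanifold $M\subset\mathbb C^{1+8}$ through the origin, an infinitesimal CR-automorphism of $M$ is a $(1,0)$ vector field $\mathsf X=Z(z,w)\,\partial_z+\sum_{l=1}^8W^l(z,w)\,\partial_{w^l}$ with coefficients holomorphic near the origin such that $\mathsf X+\overline{\mathsf X}$ is tangent to $M$. These form the real Lie algebra $\mathfrak{aut}_{CR}(M)$. "Rigid" means that the right-hand sides of the defining equations do not depend on $w$. Superscripts on $w$ are indices. $\langle\cdot\rangle$ denotes the real span. A Lie algebra $\mathfrak g$ is graded (in the sense of Tanaka) if $\mathfrak g=\mathfrak g_{-k}\oplus\cdots\oplus\mathfrak g_{k'}$ with $[\mathfrak g_i,\mathfrak g_j]\subset\mathfrak g_{i+j}$. *)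

theory Defs
  imports "HOL-Analysis.Analysis"
begin

text \<open>Points of \<open>C\<^sup>1\<^sup>+\<^sup>8\<close> are pairs \<open>(z, w)\<close>. The numeral type \<^typ>\<open>8\<close> counts modulo 8, so
  \<open>w$1, \<dots>, w$8\<close> are the eight components (\<open>w$8\<close> is the one with index \<open>0 = 8\<close>), and
  \<^const>\<open>vector\<close> enumerates them in this order; see \<open>vector_8\<close>.\<close>

type_synonym cspace = "complex \<times> (complex ^ 8)"

lemma vector_8:
  "(vector [x1, x2, x3, x4, x5, x6, x7, x8] :: ('a::zero) ^ 8) $ 1 = x1"
  "(vector [x1, x2, x3, x4, x5, x6, x7, x8] :: ('a::zero) ^ 8) $ 2 = x2"
  "(vector [x1, x2, x3, x4, x5, x6, x7, x8] :: ('a::zero) ^ 8) $ 3 = x3"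
  "(vector [x1, x2, x3, x4, x5, x6, x7, x8] :: ('a::zero) ^ 8) $ 4 = x4"
  "(vector [x1, x2, x3, x4, x5, x6, x7, x8] :: ('a::zero) ^ 8) $ 5 = x5"
  "(vector [x1, x2, x3, x4, x5, x6, x7, x8] :: ('a::zero) ^ 8) $ 6 = x6"
  "(vector [x1, x2, x3, x4, x5, x6, x7, x8] :: ('a::zero) ^ 8) $ 7 = x7"
  "(vector [x1, x2, x3, x4, x5, x6, x7, x8] :: ('a::zero) ^ 8) $ 8 = x8"
  unfolding vector_def by simp_all

subsection \<open>Germs at the origin of vector fields of type (1,0)\<close>

text \<open>The field \<open>Z \<partial>\<^sub>z + \<Sum> W\<^sup>l \<partial>\<^bsub>w\<^sup>l\<^esub>\<close> is represented by its coefficient map \<open>F = (Z, W)\<close>.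
  Two fields are identified when they agree in a neighbourhood of the origin. The type itself
  does not require holomorphy, which is imposed in \<open>aut_CR\<close>.\<close>

quotient_type vf_germ = "cspace \<Rightarrow> cspace" /
  "\<lambda>F G. \<forall>\<^sub>F p in nhds 0. F p = G p"
  by (intro equivpI reflpI sympI transpI) (auto elim: eventually_mono eventually_elim2)

lift_definition germ :: "(cspace \<Rightarrow> cspace) \<Rightarrow> vf_germ" is "\<lambda>F. F" .

instantiation vf_germ :: real_vector
begin

lift_definition zero_vf_germ :: vf_germ is "\<lambda>p. 0" .

lift_definition plus_vf_germ :: "vf_germ \<Rightarrow> vf_germ \<Rightarrow> vf_germ" is "\<lambda>F G p. F p + G p"
  by (auto elim: eventually_elim2)

lift_definition minus_vf_germ :: "vf_germ \<Rightarrow> vf_germ \<Rightarrow> vf_germ" is "\<lambda>F G p. F p - G p"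
  by (auto elim: eventually_elim2)

lift_definition uminus_vf_germ :: "vf_germ \<Rightarrow> vf_germ" is "\<lambda>F p. - F p"
  by (auto elim: eventually_mono)

lift_definition scaleR_vf_germ :: "real \<Rightarrow> vf_germ \<Rightarrow> vf_germ" is "\<lambda>r F p. r *\<^sub>R F p"
  by (auto elim: eventually_mono)

instance
  by standard (transfer; simp add: algebra_simps)+

end

text \<open>For holomorphic coefficients the derivative of a coefficient \<open>G\<^sup>k\<close> in direction \<open>F p\<close> is
  \<open>(Z \<partial>\<^sub>z + \<Sum> W\<^sup>l \<partial>\<^bsub>w\<^sup>l\<^esub>) G\<^sup>k\<close>, so the following is the commutator of (1,0) fields.\<close>

lift_definition lie_bracket :: "vf_germ \<Rightarrow> vf_germ \<Rightarrow> vf_germ"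
  is "\<lambda>F G p. frechet_derivative G (at p) (F p) - frechet_derivative F (at p) (G p)"
proof -
  fix F F' G G' :: "cspace \<Rightarrow> cspace"
  have fd: "\<forall>\<^sub>F p in nhds 0. frechet_derivative H (at p) = frechet_derivative H' (at p)"
    if "\<forall>\<^sub>F p in nhds 0. H p = H' p" for H H' :: "cspace \<Rightarrow> cspace"
  proof -
    have "\<forall>\<^sub>F p in nhds 0. \<forall>\<^sub>F q in nhds p. H q = H' q"
      using that by (simp add: eventually_eventually)
    then show ?thesis
    proof (rule eventually_mono)
      fix p assume *: "\<forall>\<^sub>F q in nhds p. H q = H' q"
      then have eq: "H p = H' p" by (rule eventually_nhds_x_imp_x)
      have ev: "\<forall>\<^sub>F q in at p. H q = H' q"
        using * by (simp add: eventually_at_filter eventually_mono)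
      then have "\<forall>\<^sub>F q in at p. H' q = H q" by (rule eventually_mono) simp
      then have "(H has_derivative D) (at p) = (H' has_derivative D) (at p)" for D
        using ev eq has_derivative_transform_eventually[of H D p UNIV H']
          has_derivative_transform_eventually[of H' D p UNIV H] by auto
      then show "frechet_derivative H (at p) = frechet_derivative H' (at p)"
        by (simp add: frechet_derivative_def)
    qed
  qed
  assume F: "\<forall>\<^sub>F p in nhds 0. F p = F' p" and G: "\<forall>\<^sub>F p in nhds 0. G p = G' p"
  show "\<forall>\<^sub>F p in nhds 0.
      frechet_derivative G (at p) (F p) - frechet_derivative F (at p) (G p) =
      frechet_derivative G' (at p) (F' p) - frechet_derivative F' (at p) (G' p)"
    using F G fd[OF F] fd[OF G] by eventually_elim simp
qed

subsection \<open>Infinitesimal CR-automorphisms\<close>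

definition cscale :: "complex \<Rightarrow> cspace \<Rightarrow> cspace"
  where "cscale c v = (c * fst v, c *s snd v)"

definition holomorphic_near :: "(cspace \<Rightarrow> cspace) \<Rightarrow> cspace set \<Rightarrow> bool"
  where "holomorphic_near F U \<longleftrightarrow> open U \<and> 0 \<in> U \<and>
    (\<forall>p\<in>U. \<exists>D. (F has_derivative D) (at p) \<and> (\<forall>c v. D (cscale c v) = cscale c (D v)))"

text \<open>Real tangent vectors of a subset of \<open>C\<^sup>1\<^sup>+\<^sup>8\<close> as velocities of curves lying in it. For an
  embedded submanifold this is the usual tangent space.\<close>

definition tangent_space :: "cspace set \<Rightarrow> cspace \<Rightarrow> cspace set"
  where "tangent_space M p = {v. \<exists>\<gamma> :: real \<Rightarrow> cspace. \<gamma> 0 = p \<and> (\<forall>\<^sub>F t in nhds 0. \<gamma> t \<in> M) \<and>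
    (\<gamma> has_vector_derivative v) (at 0)}"

text \<open>\<open>X + cnj X\<close> is the real vector field whose value at \<open>p\<close>, an element of \<open>C\<^sup>9 = R\<^sup>1\<^sup>8\<close>, is the
  coefficient vector \<open>F p\<close> of \<open>X\<close>, because \<open>Z \<partial>\<^sub>z + cnj Z \<partial>\<^bsub>cnj z\<^esub> = Re Z \<partial>\<^sub>x + Im Z \<partial>\<^sub>y\<close>.\<close>

definition aut_CR :: "cspace set \<Rightarrow> vf_germ set"
  where "aut_CR M = {germ F |F. \<exists>U. holomorphic_near F U \<and> (\<forall>p\<in>M \<inter> U. F p \<in> tangent_space M p)}"

subsection \<open>Graded real Lie algebras\<close>

definition real_lie_algebra :: "('a::real_vector \<Rightarrow> 'a \<Rightarrow> 'a) \<Rightarrow> 'a set \<Rightarrow> bool"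
  where "real_lie_algebra br L \<longleftrightarrow> subspace L \<and>
    (\<forall>x\<in>L. \<forall>y\<in>L. br x y \<in> L) \<and>
    (\<forall>x\<in>L. \<forall>y\<in>L. \<forall>u\<in>L. \<forall>a b. br (a *\<^sub>R x + b *\<^sub>R y) u = a *\<^sub>R br x u + b *\<^sub>R br y u) \<and>
    (\<forall>x\<in>L. \<forall>y\<in>L. \<forall>u\<in>L. \<forall>a b. br u (a *\<^sub>R x + b *\<^sub>R y) = a *\<^sub>R br u x + b *\<^sub>R br u y) \<and>
    (\<forall>x\<in>L. br x x = 0) \<and>
    (\<forall>x\<in>L. \<forall>y\<in>L. \<forall>u\<in>L. br x (br y u) + br y (br u x) + br u (br x y) = 0)"

text \<open>\<open>L\<close> is the direct sum of \<open>g l, \<dots>, g m\<close>; the components of degree outside \<open>{l..m}\<close> are zero.\<close>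

definition graded_lie_algebra ::
    "('a::real_vector \<Rightarrow> 'a \<Rightarrow> 'a) \<Rightarrow> 'a set \<Rightarrow> int \<Rightarrow> int \<Rightarrow> (int \<Rightarrow> 'a set) \<Rightarrow> bool"
  where "graded_lie_algebra br L l m g \<longleftrightarrow> real_lie_algebra br L \<and>
    (\<forall>i. subspace (g i) \<and> g i \<subseteq> L) \<and>
    (\<forall>i. i \<notin> {l..m} \<longrightarrow> g i = {0}) \<and>
    (\<forall>x\<in>L. \<exists>!f. f \<in> (\<Pi>\<^sub>E i\<in>{l..m}. g i) \<and> x = (\<Sum>i=l..m. f i)) \<and>
    (\<forall>i j. \<forall>x\<in>g i. \<forall>y\<in>g j. br x y \<in> g (i + j))"

subsection \<open>The model and its vector fields\<close>

definition M1 :: "cspace set"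
  where "M1 = {(z, w).
    w$1 - cnj (w$1) = 2 * \<i> * z * cnj z \<and>
    w$2 - cnj (w$2) = 2 * \<i> * (z^2 * cnj z + z * (cnj z)^2) \<and>
    w$3 - cnj (w$3) = 2 * (z^2 * cnj z - z * (cnj z)^2) \<and>
    w$4 - cnj (w$4) = 2 * \<i> * (z^3 * cnj z + z * (cnj z)^3) \<and>
    w$5 - cnj (w$5) = 2 * (z^3 * cnj z - z * (cnj z)^3) \<and>
    w$6 - cnj (w$6) = 2 * \<i> * z^2 * (cnj z)^2 \<and>
    w$7 - cnj (w$7) = 2 * \<i> * (z^4 * cnj z + z * (cnj z)^4) \<and>
    w$8 - cnj (w$8) = 2 * (z^4 * cnj z - z * (cnj z)^4)}"

definition dw :: "8 \<Rightarrow> vf_germ"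
  where "dw l = germ (\<lambda>_. (0, axis l 1))"

definition XF :: "nat \<Rightarrow> vf_germ"
  where "XF i =
    (if i = 9 then germ (\<lambda>(z, w). (z,
       vector [2 * w$1, 3 * w$2, 3 * w$3, 4 * w$4, 4 * w$5, 4 * w$6, 5 * w$7, 5 * w$8]))
     else if i = 10 then germ (\<lambda>(z, w). (\<i> * z,
       vector [0, - w$3, w$2, - 2 * w$5, 2 * w$4, 0, - 3 * w$8, 3 * w$7]))
     else if i = 11 then germ (\<lambda>(z, w). (1,
       vector [2 * \<i> * z,
               4 * w$1 + 2 * \<i> * z^2,
               2 * z^2,
               3 * w$2 + 2 * \<i> * z^3,
               3 * w$3 + 2 * z^3,
               2 * w$2,
               4 * w$4 + 2 * \<i> * z^4,
               4 * w$5 + 2 * z^4]))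
     else if i = 12 then germ (\<lambda>(z, w). (\<i>,
       vector [2 * z,
               2 * z^2,
               4 * w$1 - 2 * \<i> * z^2,
               - 3 * w$3 + 2 * z^3,
               3 * w$2 - 2 * \<i> * z^3,
               2 * w$3,
               - 4 * w$5 + 2 * z^4,
               4 * w$4 - 2 * \<i> * z^4]))
     else dw (of_nat i))"

definition gr :: "int \<Rightarrow> vf_germ set"
  where "gr k =
    (if k = -5 then span {XF 7, XF 8}
     else if k = -4 then span {XF 4, XF 5, XF 6}
     else if k = -3 then span {XF 2, XF 3}
     else if k = -2 then span {XF 1}
     else if k = -1 then span {XF 11, XF 12}
     else if k = 0 then span {XF 9, XF 10}
     else {0})"

end

theory Submission
  imports Defs "HOL-Complex_Analysis.Conformal_Mappings"
begin

text \<open>Let \<open>X = Z \<partial>\<^sub>z + \<Sum> W\<^sup>l \<partial>\<^bsub>w\<^sup>l\<^esub>\<close> be an infinitesimal CR-automorphism. A complex linear change of the variables \<open>w\<close>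
  (\<open>to_y\<close>) gives one coordinate \<open>y\<^sub>a\<^sub>b\<close> for each of the eight exponent pairs
  \<open>(1,1), (2,1), (1,2), (3,1), (1,3), (2,2), (4,1), (1,4)\<close>, and the model becomes
  \<open>y\<^sub>a\<^sub>b + cnj y\<^sub>b\<^sub>a = z\<^sup>a (cnj z)\<^sup>b\<close>. With \<open>V\<close> for the components of \<open>X\<close> along \<open>y\<close>, tangency says that on the
  model \<open>V\<^sub>a\<^sub>b + cnj V\<^sub>b\<^sub>a\<close> is the derivative of \<open>z\<^sup>a (cnj z)\<^sup>b\<close> along \<open>Z\<close>. Within the complexified model the real points
  form a totally real set of maximal dimension, so the identity theorem, applied on complex lines through real points, allows
  \<open>cnj z\<close> and \<open>cnj y\<close> to be replaced by independent variables (\<open>tangency_complexified\<close>):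
  \<open>V\<^sub>a\<^sub>b(z, y) - V'\<^sub>a\<^sub>b(\<zeta>, y') = a z\<^bsup>a-1\<^esup> \<zeta>\<^sup>b Z(z, y) + b z\<^sup>a \<zeta>\<^bsup>b-1\<^esup> Z'(\<zeta>, y')\<close> whenever \<open>y - y'\<close> has the components
  \<open>z\<^sup>a \<zeta>\<^sup>b\<close>; here \<open>Z'\<close>, \<open>V'\<close> are the reflections of \<open>Z\<close>, \<open>V\<close>.

  Putting \<open>\<zeta> = 0\<close> or \<open>z = 0\<close> expresses \<open>V\<close> and \<open>V'\<close> through \<open>g\<^sub>a\<^sub>b(y) = V\<^sub>a\<^sub>b(0, y)\<close> and the values \<open>Z(0, y)\<close>,
  \<open>Z'(0, y)\<close>. What remains for \<open>(1,2), (1,3), (1,4)\<close> is the locale \<open>half_system\<close>; the pairs \<open>(2,1), (3,1), (4,1)\<close> give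
  a second instance, with the two sets of variables exchanged. The terms of first order at \<open>z = 0\<close> and at
  \<open>\<zeta> = 0\<close> and, for the direction \<open>e\<^sub>2\<^sub>2\<close>, a combination of the equations that is free of \<open>Z\<close> and \<open>Z'\<close>
  determine every derivative of \<open>g\<^sub>1\<^sub>3\<close> and \<open>g\<^sub>1\<^sub>4\<close> needed here. With \<open>p = Z'(0, y)\<close>, \<open>A = \<partial>\<^sub>z Z(0, y)\<close>,
  \<open>C = \<partial>\<^sub>\<zeta> Z'(0, y)\<close> they vanish along \<open>e\<^sub>a\<^sub>1\<close> and \<open>e\<^sub>2\<^sub>2\<close>, and along \<open>e\<^sub>1\<^sub>2, e\<^sub>1\<^sub>3, e\<^sub>1\<^sub>4\<close> the values are
  \<open>3 p, A + 3 C, *\<close> for \<open>g\<^sub>1\<^sub>3\<close> and \<open>0, 4 p, A + 4 C\<close> for \<open>g\<^sub>1\<^sub>4\<close>. A function that is constant along a direction has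
  derivatives that are constant along it, so \<open>p\<close>, \<open>A\<close>, \<open>C\<close> are constant along \<open>e\<^sub>a\<^sub>1\<close> and \<open>e\<^sub>2\<^sub>2\<close>. By the second instance
  \<open>A\<close> and \<open>C\<close> are constant along \<open>e\<^sub>1\<^sub>b\<close> too, hence constant. If \<open>Z\<close>, \<open>\<partial>\<^sub>z Z\<close> and \<open>W\<close> vanish at the origin, then
  \<open>A = C = 0\<close>; the same argument makes \<open>p\<close> constant, thus zero, and \<open>g\<^sub>1\<^sub>4\<close>, \<open>g\<^sub>4\<^sub>1\<close> are constant. The equations
  for these two pairs are then linear in \<open>\<zeta> Z\<close> and \<open>z Z'\<close> and nonsingular, so \<open>Z = 0\<close>, after which \<open>V\<close> has to be
  invariant under all the translations \<open>(z\<^sup>a \<zeta>\<^sup>b)\<close> and is constant as well (\<open>rigidity_of_complexified_system\<close>).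

  So an automorphism is determined by \<open>Z(0)\<close>, \<open>\<partial>\<^sub>z Z(0)\<close> and \<open>W(0)\<close>, where \<open>W(0)\<close> is real by tangency at the
  origin: \<open>2 + 2 + 8 = 12\<close> real parameters. All of them are attained by the polynomial
  fields \<open>field_of c\<close>, the real combinations of the \<open>X\<^sub>i\<close>, which are tangent by direct computation
  (\<open>aut_CR_M1\<close>). Their commutator is given by an explicit bilinear map \<open>bracket_coeffs\<close> on coefficient vectors
  (\<open>lie_bracket_field_germ\<close>). The axioms of a Lie algebra, the grading and the table of commutators are
  identities for this map.\<close>

section \<open>Identity principles and invariant directions\<close>

lemma poly_zero_near_0:
  fixes p :: "complex poly"
  assumes "\<delta> > 0" and "\<And>x. norm x < \<delta> \<Longrightarrow> poly p x = 0"
  shows "p = 0"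
proof (rule ccontr)
  assume "p \<noteq> 0"
  then have "finite {x. poly p x = 0}" by (rule poly_roots_finite)
  moreover have "ball 0 \<delta> \<subseteq> {x. poly p x = 0}" using assms by (auto simp: dist_norm)
  ultimately have "finite (ball (0::complex) \<delta>)" using finite_subset by blast
  then show False using assms(1) uncountable_ball[OF assms(1), of "0::complex"] countable_finite by blast
qed

text \<open>Coefficients of an identity whose last term is only known to have a limit are read off one at a time:
  the constant term is a limit of zeros, and what is left can be divided by \<open>x\<close>.\<close>

lemma peel_constant_term:
  fixes f :: "complex \<Rightarrow> complex"
  assumes "\<forall>\<^sub>F x in at 0. c + x * f x = 0" and "(f \<longlongrightarrow> l) (at 0)"
  shows "c = 0 \<and> (\<forall>\<^sub>F x in at 0. f x = 0) \<and> l = 0"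
proof -
  have "((\<lambda>x. c + x * f x) \<longlongrightarrow> c + 0 * l) (at 0)"
    by (intro tendsto_intros assms(2))
  moreover have "((\<lambda>x. c + x * f x) \<longlongrightarrow> 0) (at 0)"
    using assms(1) by (rule tendsto_eventually)
  ultimately have c: "c = 0" using tendsto_unique[of "at (0::complex)"] by fastforce
  have f0: "\<forall>\<^sub>F x in at 0. f x = 0"
    using assms(1) eventually_at_ball'[of 1 0 UNIV] unfolding c
    by (auto elim!: eventually_elim2 simp: eventually_at_filter)
  then have "(f \<longlongrightarrow> 0) (at 0)" by (rule tendsto_eventually)
  then have "l = 0" using assms(2) tendsto_unique[of "at (0::complex)"] by fastforce
  with c f0 show ?thesis by blast
qed

lemma has_derivative_along:
  assumes "(\<gamma> has_derivative \<gamma>') (at x within S)" and "(f has_derivative D) (at y)" and "\<gamma> x = y"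
  shows "((\<lambda>x. f (\<gamma> x)) has_derivative (\<lambda>h. D (\<gamma>' h))) (at x within S)"
  using has_derivative_compose[OF assms(1), of f D] assms(2,3) by simp

lemma bounded_linear_smult: "bounded_linear (\<lambda>c::complex. c *s (v::complex^8))"
  by (intro linear_conv_bounded_linear[THEN iffD1] linearI)
    (simp_all add: vec_eq_iff algebra_simps)

lemma has_derivative_smult:
  fixes v :: "complex^8"
  assumes "(f has_field_derivative f') (at z)"
  shows "((\<lambda>z. f z *s v) has_derivative (\<lambda>h. h *s (f' *s v))) (at z)"
  using bounded_linear.has_derivative[OF bounded_linear_smult[of v] assms[unfolded has_field_derivative_def]]
  by (simp add: vector_smult_assoc mult.commute)

text \<open>The bidegrees of the eight monomials in the defining equations, once the equations for
  \<open>w\<^sup>2 \<plusminus> \<i> w\<^sup>3\<close> and so on are used in place of those for \<open>w\<^sup>2\<close> and \<open>w\<^sup>3\<close>.\<close>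

definition exps :: "(nat \<times> nat) set"
  where "exps = {(1,1), (2,1), (1,2), (3,1), (1,3), (2,2), (4,1), (1,4)}"

text \<open>The directions \<open>E\<close> are kept variable because the second half of the equations uses the
  same surface with the exponents exchanged and with the opposite sign.\<close>

definition monomials :: "(nat \<Rightarrow> nat \<Rightarrow> complex^8) \<Rightarrow> complex \<Rightarrow> complex \<Rightarrow> complex^8"
  where "monomials E z \<zeta> = (\<Sum>(a,b)\<in>exps. (z ^ a * \<zeta> ^ b) *s E a b)"

definition monomials_dz :: "(nat \<Rightarrow> nat \<Rightarrow> complex^8) \<Rightarrow> complex \<Rightarrow> complex \<Rightarrow> complex^8"
  where "monomials_dz E z \<zeta> = (\<Sum>(a,b)\<in>exps. (of_nat a * z ^ (a - 1) * \<zeta> ^ b) *s E a b)"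

lemma monomials_0 [simp]: "monomials E 0 \<zeta> = 0" "monomials E z 0 = 0"
  by (auto simp: monomials_def exps_def)

lemma monomials_swap: "monomials (\<lambda>a b. E b a) z \<zeta> = monomials E \<zeta> z"
  by (simp add: monomials_def exps_def algebra_simps)

lemma monomials_uminus: "monomials (\<lambda>a b. - E a b) z \<zeta> = - monomials E z \<zeta>"
  by (simp add: monomials_def exps_def vec_eq_iff)

lemma has_derivative_monomials:
  "((\<lambda>z. y + monomials E z \<zeta>) has_derivative (\<lambda>h. h *s monomials_dz E z \<zeta>)) (at z)"
proof -
  have "((\<lambda>z. y + monomials E z \<zeta>) has_derivative
     (\<lambda>h. 0 + (\<Sum>x\<in>exps. h *s ((of_nat (fst x) * z ^ (fst x - 1) * \<zeta> ^ (snd x)) *s E (fst x) (snd x))))) (at z)"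
    unfolding monomials_def case_prod_unfold
    by (intro has_derivative_add has_derivative_const has_derivative_sum has_derivative_smult)
      (auto intro!: derivative_eq_intros)
  then show ?thesis
    unfolding monomials_dz_def case_prod_unfold vec.scale_sum_right add_0_left .
qed

lemma continuous_on_monomials: "continuous_on S (\<lambda>p. monomials E (fst p) (snd p))"
  unfolding monomials_def case_prod_unfold
  by (intro continuous_intros linear_continuous_on_compose[of _ "\<lambda>p. p ^ _ * _ ^ _"]
      bounded_linear.continuous_on[OF bounded_linear_smult])

lemma monomials_small:
  assumes "\<epsilon> > 0"
  obtains \<delta> :: real where "\<delta> > 0"
    and "\<And>z \<zeta>. norm z < \<delta> \<Longrightarrow> norm \<zeta> < \<delta> \<Longrightarrow> norm (monomials E z \<zeta>) < \<epsilon>"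
proof -
  have op: "open {p. norm (monomials E (fst p) (snd p)) < \<epsilon>}"
    by (intro open_Collect_less continuous_intros continuous_on_monomials)
  then obtain e where e: "e > 0" "ball (0, 0) e \<subseteq> {p. norm (monomials E (fst p) (snd p)) < \<epsilon>}"
    using assms open_contains_ball[of "{p. norm (monomials E (fst p) (snd p)) < \<epsilon>}"] by fastforce
  show ?thesis
  proof (rule that[of "e / 2"])
    fix z \<zeta> :: complex assume "norm z < e / 2" "norm \<zeta> < e / 2"
    then have "norm (z, \<zeta>) < e" using norm_Pair_le[of z \<zeta>] by simp
    then have "(z, \<zeta>) \<in> ball (0, 0) e" by (simp flip: zero_prod_def)
    then show "norm (monomials E z \<zeta>) < \<epsilon>" using e(2) by auto
  qed (use e in simp)
qed

lemma clinear_monomials_dz: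
  fixes T :: "complex^8 \<Rightarrow> complex"
  assumes "linear T" "\<And>c v. T (c *s v) = c * T v"
  shows "T (monomials_dz E z \<zeta>) = (\<Sum>(a,b)\<in>exps. (of_nat a * z ^ (a - 1) * \<zeta> ^ b) * T (E a b))"
  unfolding monomials_dz_def case_prod_unfold
  by (simp add: linear_sum[OF assms(1)] assms(2) case_prod_unfold)

definition inv_along :: "real \<Rightarrow> complex^8 \<Rightarrow> (complex^8 \<Rightarrow> complex) \<Rightarrow> bool"
  where "inv_along r e f \<longleftrightarrow> (\<forall>y t. norm y < r \<longrightarrow> norm (y + t *s e) < r \<longrightarrow> f (y + t *s e) = f y)"

lemma inv_along_uminus: "inv_along r (- e) f \<Longrightarrow> inv_along r e f"
  unfolding inv_along_def
proof (intro allI impI)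
  fix y t assume *: "\<forall>y t. norm y < r \<longrightarrow> norm (y + t *s - e) < r \<longrightarrow> f (y + t *s - e) = f y"
    and "norm y < r" "norm (y + t *s e) < r"
  moreover have "t *s e = (-t) *s (-e)" by (simp add: vec_eq_iff)
  ultimately show "f (y + t *s e) = f y" by metis
qed

lemma inv_along_zero_derivative:
  assumes d: "\<And>y. norm y < r \<Longrightarrow> (f has_derivative D y) (at y)"
    and s: "\<And>y c v. norm y < r \<Longrightarrow> D y (c *s v) = c * D y v"
    and z: "\<And>y. norm y < r \<Longrightarrow> D y e = 0"
  shows "inv_along r e f"
  unfolding inv_along_def
proof (intro allI impI)
  fix y t assume y: "norm y < r" "norm (y + t *s e) < r"
  have seg: "norm (y + (of_real s * t) *s e) < r" if "s \<in> {0..1}" for s :: real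
  proof -
    have "y + (of_real s * t) *s e = (1 - s) *\<^sub>R y + s *\<^sub>R (y + t *s e)"
      unfolding vec_eq_iff vector_add_component vector_scaleR_component vector_smult_component
      by (simp add: scaleR_conv_of_real algebra_simps)
    moreover have "(1 - s) *\<^sub>R y + s *\<^sub>R (y + t *s e) \<in> ball 0 r"
      using y that by (intro convexD[OF convex_ball]) auto
    ultimately show ?thesis by simp
  qed
  have "((\<lambda>s. f (y + (of_real s * t) *s e)) has_derivative (\<lambda>h. 0)) (at s within {0..1})"
    if "s \<in> {0..1}" for s :: real
  proof -
    have "((\<lambda>s::real. y + of_real s *s (t *s e)) has_derivative (\<lambda>h. 0 + of_real h *s (t *s e))) (at s within {0..1})"
      by (intro has_derivative_add has_derivative_const
          bounded_linear.has_derivative[OF bounded_linear_smult] has_derivative_of_real has_derivative_ident)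
    then have "((\<lambda>s::real. f (y + of_real s *s (t *s e))) has_derivative
        (\<lambda>h. D (y + of_real s *s (t *s e)) (0 + of_real h *s (t *s e)))) (at s within {0..1})"
      by (rule has_derivative_along[OF _ d])
        (use seg[OF that] in \<open>simp_all add: vector_smult_assoc\<close>)
    then show ?thesis
      using s[OF seg[OF that]] z[OF seg[OF that]] by (simp add: vector_smult_assoc)
  qed
  then have "\<And>u v. u \<in> {0..1} \<Longrightarrow> v \<in> {0..1} \<Longrightarrow>
      f (y + (of_real u * t) *s e) = f (y + (of_real v * t) *s e)"
    by (rule has_derivative_zero_unique[of "{0..1::real}", rotated 1]) simp_all
  from this[of 1 0] show "f (y + t *s e) = f y" by simp
qed

text \<open>This replaces the symmetry of mixed partial derivatives: \<open>f\<close> and its translate along \<open>e\<close> are the same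
  function near each point, so their derivatives agree.\<close>

lemma inv_along_derivative:
  assumes i: "inv_along r e f" and d: "\<And>y. norm y < r \<Longrightarrow> (f has_derivative D y) (at y)"
  shows "inv_along r e (\<lambda>y. D y v)"
  unfolding inv_along_def
proof (intro allI impI)
  fix y t assume y: "norm y < r" "norm (y + t *s e) < r"
  have "((\<lambda>x. x + t *s e) has_derivative (\<lambda>h. h)) (at y)"
    by (auto intro!: derivative_eq_intros)
  then have 1: "((\<lambda>x. f (x + t *s e)) has_derivative (\<lambda>h. D (y + t *s e) h)) (at y)"
    by (rule has_derivative_along[OF _ d[OF y(2)]]) simp
  have op: "open {x. norm x < r \<and> norm (x + t *s e) < r}"
    by (intro open_Collect_conj open_Collect_less continuous_intros)
  have "\<forall>\<^sub>F x in nhds y. norm x < r \<and> norm (x + t *s e) < r"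
    using eventually_nhds_in_open[OF op, of y] y by simp
  then have ev: "\<forall>\<^sub>F x in nhds y. f (x + t *s e) = f x"
    by (rule eventually_mono) (use i in \<open>auto simp: inv_along_def\<close>)
  have "(f has_derivative (\<lambda>h. D (y + t *s e) h)) (at y)"
  proof (rule has_derivative_transform_eventually[where f = "\<lambda>x. f (x + t *s e)"])
    show "\<forall>\<^sub>F x in at y. f (x + t *s e) = f x"
      using ev by (simp add: eventually_at_filter eventually_mono)
    show "f (y + t *s e) = f y" using ev by (rule eventually_nhds_x_imp_x)
  qed (use 1 in simp_all)
  then have "D (y + t *s e) = D y" using d[OF y(1)] has_derivative_unique by blast
  then show "D (y + t *s e) v = D y v" by simp
qed

text \<open>The coordinates of \<open>y\<close> are set to zero one after the other; the norm does not increase, so the path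
  stays in the ball where invariance is known.\<close>

lemma inv_along_axes_constant:
  assumes i: "\<And>k. inv_along r (axis k 1) f" and y: "norm y < r"
  shows "f y = f 0"
proof -
  define g where "g S = (\<chi> k. if k \<in> S then 0 else y $ k)" for S
  have gn: "norm (g S) < r" for S
  proof -
    have "norm (g S) \<le> norm y" by (rule norm_le_componentwise_cart) (simp add: g_def)
    then show ?thesis using y by simp
  qed
  have "f (g S) = f y" if "finite S" for S
    using that
  proof (induction S)
    case empty then show ?case by (simp add: g_def)
  next
    case (insert k S)
    have "g S = g (insert k S) + (y $ k) *s axis k 1"
      using insert.hyps by (auto simp: g_def vec_eq_iff axis_def)
    then have "f (g S) = f (g (insert k S))"
      using i[of k] gn[of S] gn[of "insert k S"] unfolding inv_along_def by metis
    then show ?case using insert.IH by simp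
  qed
  from this[of UNIV] show ?thesis by (simp add: g_def zero_vec_def[symmetric])
qed

section \<open>One half of the complexified equations\<close>

lemma has_field_derivative_along_monomials:
  assumes "(f has_derivative T) (at (y + monomials E z \<zeta>))" and "\<And>c v. T (c *s v) = c * T v"
  shows "((\<lambda>z. f (y + monomials E z \<zeta>)) has_field_derivative T (monomials_dz E z \<zeta>)) (at z)"
proof -
  have "((\<lambda>z. f (y + monomials E z \<zeta>)) has_derivative (\<lambda>h. T (h *s monomials_dz E z \<zeta>))) (at z)"
    by (rule has_derivative_along[OF has_derivative_monomials assms(1)]) simp
  then show ?thesis
    by (simp add: has_field_derivative_def assms(2) mult_commute_abs)
qed

lemma monomials_dz_expand:
  assumes "linear T" "\<And>c v. T (c *s v) = c * T v"
  shows "T (monomials_dz E z \<zeta>) = \<zeta> * T (E 1 1) + \<zeta>^2 * T (E 1 2) + \<zeta>^3 * T (E 1 3) + \<zeta>^4 * T (E 1 4)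
     + 2 * z * (\<zeta> * T (E 2 1) + \<zeta>^2 * T (E 2 2)) + 3 * z^2 * \<zeta> * T (E 3 1) + 4 * z^3 * \<zeta> * T (E 4 1)"
  by (simp add: clinear_monomials_dz[OF assms] exps_def algebra_simps eval_nat_numeral)

text \<open>The base point is moved to \<open>y - monomials E z \<zeta>\<close>, so that the curve \<open>z \<mapsto> monomials E z \<zeta>\<close> passes through \<open>y\<close>
  with a velocity that belongs to an arbitrary small \<open>z\<close>; this sees more directions than velocities
  at \<open>z = 0\<close>. The function may depend on the parameter \<open>\<zeta>\<close>, which is fixed along the curve.\<close>

lemma derivative_along_invariance:
  assumes r: "r > 0" and y: "norm y < r"
    and d: "\<And>\<zeta>. (f \<zeta> has_derivative T \<zeta>) (at y)" and s: "\<And>\<zeta> c v. T \<zeta> (c *s v) = c * T \<zeta> v"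
    and i: "\<And>z \<zeta> x. norm z < r \<Longrightarrow> norm \<zeta> < r \<Longrightarrow> norm x < r \<Longrightarrow> f \<zeta> (x + monomials E z \<zeta>) = f \<zeta> x"
  obtains \<delta> :: real where "\<delta> > 0"
    and "\<And>z \<zeta>. norm z < \<delta> \<Longrightarrow> norm \<zeta> < \<delta> \<Longrightarrow> T \<zeta> (monomials_dz E z \<zeta>) = 0"
proof -
  obtain \<delta>0 where d0: "\<delta>0 > 0"
    and d0': "\<And>z \<zeta>. norm z < \<delta>0 \<Longrightarrow> norm \<zeta> < \<delta>0 \<Longrightarrow> norm (monomials E z \<zeta>) < r - norm y"
    using monomials_small[of "r - norm y" E] y by auto
  define \<delta> where "\<delta> = min \<delta>0 r"
  show ?thesis
  proof (rule that)
    show "\<delta> > 0" using d0 r by (simp add: \<delta>_def)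
    fix z \<zeta> :: complex assume z: "norm z < \<delta>" and \<zeta>: "norm \<zeta> < \<delta>"
    define x where "x = y - monomials E z \<zeta>"
    have x: "norm x < r"
      using norm_triangle_ineq4[of y "monomials E z \<zeta>"] d0'[of z \<zeta>] z \<zeta> by (simp add: x_def \<delta>_def)
    have ev: "\<forall>\<^sub>F u in nhds z. f \<zeta> (x + monomials E u \<zeta>) = f \<zeta> x"
      using eventually_nhds_in_open[of "ball (0::complex) r" z] z i[OF _ _ x] \<zeta>
      by (auto elim!: eventually_mono simp: \<delta>_def dist_norm)
    have "((\<lambda>u. f \<zeta> (x + monomials E u \<zeta>)) has_field_derivative T \<zeta> (monomials_dz E z \<zeta>)) (at z)"
      using d[of \<zeta>] by (intro has_field_derivative_along_monomials s) (simp add: x_def)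
    moreover have "((\<lambda>u. f \<zeta> (x + monomials E u \<zeta>)) has_field_derivative 0) (at z)"
      using DERIV_cong_ev[OF refl ev refl] by simp
    ultimately show "T \<zeta> (monomials_dz E z \<zeta>) = 0" using DERIV_unique by blast
  qed
qed

text \<open>Up to numerical factors the four conclusions are the coefficients of \<open>1, z, z\<^sup>2, z\<^sup>3\<close>.\<close>

lemma monomials_dz_coeffs:
  assumes T: "linear T" "\<And>c v. T (c *s v) = c * T v" and d: "\<delta> > 0"
    and 0: "\<And>z. norm z < \<delta> \<Longrightarrow> T (monomials_dz E z \<zeta>) = 0"
  shows "\<zeta> * T (E 1 1) + \<zeta>^2 * T (E 1 2) + \<zeta>^3 * T (E 1 3) + \<zeta>^4 * T (E 1 4) = 0"
    and "\<zeta> * T (E 2 1) + \<zeta>^2 * T (E 2 2) = 0" and "\<zeta> * T (E 3 1) = 0" and "\<zeta> * T (E 4 1) = 0"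
proof -
  have "[:\<zeta> * T (E 1 1) + \<zeta>^2 * T (E 1 2) + \<zeta>^3 * T (E 1 3) + \<zeta>^4 * T (E 1 4),
        2 * (\<zeta> * T (E 2 1) + \<zeta>^2 * T (E 2 2)), 3 * (\<zeta> * T (E 3 1)), 4 * (\<zeta> * T (E 4 1)):] = 0"
  proof (rule poly_zero_near_0[OF d])
    fix z :: complex assume "norm z < \<delta>"
    from 0[OF this] show "poly [:\<zeta> * T (E 1 1) + \<zeta>^2 * T (E 1 2) + \<zeta>^3 * T (E 1 3) + \<zeta>^4 * T (E 1 4),
      2 * (\<zeta> * T (E 2 1) + \<zeta>^2 * T (E 2 2)), 3 * (\<zeta> * T (E 3 1)), 4 * (\<zeta> * T (E 4 1)):] z = 0"
      unfolding monomials_dz_expand[OF T] by (simp add: algebra_simps eval_nat_numeral)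
  qed
  then have "\<zeta> * T (E 1 1) + \<zeta>^2 * T (E 1 2) + \<zeta>^3 * T (E 1 3) + \<zeta>^4 * T (E 1 4) = 0 \<and>
    2 * (\<zeta> * T (E 2 1) + \<zeta>^2 * T (E 2 2)) = 0 \<and> 3 * (\<zeta> * T (E 3 1)) = 0 \<and> 4 * (\<zeta> * T (E 4 1)) = 0"
    unfolding pCons_eq_0_iff by blast
  then show "\<zeta> * T (E 1 1) + \<zeta>^2 * T (E 1 2) + \<zeta>^3 * T (E 1 3) + \<zeta>^4 * T (E 1 4) = 0"
    "\<zeta> * T (E 2 1) + \<zeta>^2 * T (E 2 2) = 0" "\<zeta> * T (E 3 1) = 0" "\<zeta> * T (E 4 1) = 0"
    unfolding mult_eq_0_iff[of "numeral _"] by (blast dest: zero_neq_numeral[THEN notE, OF sym])+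
qed

lemma clinear_zero_on_basis:
  assumes T: "linear T" "\<And>c v. T (c *s v) = c * T v" and d: "\<delta> > 0"
    and 0: "\<And>z \<zeta>. norm z < \<delta> \<Longrightarrow> norm \<zeta> < \<delta> \<Longrightarrow> T (monomials_dz E z \<zeta>) = 0"
    and ab: "(a, b) \<in> exps"
  shows "T (E a b) = 0"
proof -
  have c: "\<zeta> * T (E 1 1) + \<zeta>^2 * T (E 1 2) + \<zeta>^3 * T (E 1 3) + \<zeta>^4 * T (E 1 4) = 0"
    "\<zeta> * T (E 2 1) + \<zeta>^2 * T (E 2 2) = 0" "\<zeta> * T (E 3 1) = 0" "\<zeta> * T (E 4 1) = 0"
    if "norm \<zeta> < \<delta>" for \<zeta>
    by (rule monomials_dz_coeffs[OF T d 0[OF _ that]], assumption)+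
  have "[:0, T (E 1 1), T (E 1 2), T (E 1 3), T (E 1 4):] = 0"
    by (rule poly_zero_near_0[OF d], drule c(1))
      (simp add: algebra_simps power2_eq_square power3_eq_cube power4_eq_xxxx)
  moreover have "[:0, T (E 2 1), T (E 2 2):] = 0"
    by (rule poly_zero_near_0[OF d], drule c(2)) (simp add: algebra_simps power2_eq_square)
  moreover have "[:0, T (E 3 1):] = 0"
    by (rule poly_zero_near_0[OF d], drule c(3)) simp
  moreover have "[:0, T (E 4 1):] = 0"
    by (rule poly_zero_near_0[OF d], drule c(4)) simp
  ultimately show ?thesis using ab unfolding exps_def by auto
qed

text \<open>The equations for the exponent pairs \<open>(1, b)\<close>, \<open>b = 2, 3, 4\<close>, after the elimination of \<open>V\<close> and \<open>V'\<close>. The function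
  \<open>G b\<close> stands for \<open>V\<^sub>1\<^sub>b(0, y)\<close> and \<open>Y\<close> for \<open>Z'\<close>. The complex derivatives \<open>D\<close>, \<open>A\<close>, \<open>B\<close>, \<open>C\<close> are parameters in order that
  the two instances can share them: \<open>A\<close> and \<open>C\<close> change places in the second one.\<close>

locale half_system =
  fixes r :: real and E :: "nat \<Rightarrow> nat \<Rightarrow> complex^8"
    and G :: "nat \<Rightarrow> complex^8 \<Rightarrow> complex" and D :: "nat \<Rightarrow> complex^8 \<Rightarrow> complex^8 \<Rightarrow> complex"
    and Z Y :: "complex \<Rightarrow> complex^8 \<Rightarrow> complex"
    and A C :: "complex^8 \<Rightarrow> complex" and B :: "complex^8 \<Rightarrow> complex^8 \<Rightarrow> complex"
  assumes r_pos: "r > 0"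
    and G_deriv: "b \<in> {2,3,4} \<Longrightarrow> norm y < r \<Longrightarrow> (G b has_derivative D b y) (at y)"
    and D_scale: "b \<in> {2,3,4} \<Longrightarrow> norm y < r \<Longrightarrow> D b y (c *s v) = c * D b y v"
    and Z_deriv: "norm y < r \<Longrightarrow> ((\<lambda>(z, v). Z z v) has_derivative (\<lambda>(h, v). A y * h + B y v)) (at (0, y))"
    and B_linear: "norm y < r \<Longrightarrow> linear (B y)"
    and B_scale: "norm y < r \<Longrightarrow> B y (c *s v) = c * B y v"
    and Z_cont: "norm z < r \<Longrightarrow> norm y < r \<Longrightarrow> isCont (Z z) y"
    and Y_deriv: "norm y < r \<Longrightarrow> ((\<lambda>\<zeta>. Y \<zeta> y) has_field_derivative C y) (at 0)"
    and system: "b \<in> {2,3,4} \<Longrightarrow> norm z < r \<Longrightarrow> norm \<zeta> < r \<Longrightarrow> norm y < r \<Longrightarrow>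
      G b (y + monomials E z \<zeta>) - G b y =
        \<zeta> ^ b * (Z z (y + monomials E z \<zeta>) - Z 0 y) + of_nat b * z * \<zeta> ^ (b - 1) * Y \<zeta> y"
begin

lemma D_linear: "b \<in> {2,3,4} \<Longrightarrow> norm y < r \<Longrightarrow> linear (D b y)"
  using G_deriv has_derivative_linear by blast

lemma near_0: "\<forall>\<^sub>F z in nhds (0::complex). norm z < r"
  using eventually_nhds_in_open[of "ball (0::complex) r" 0] r_pos by (simp add: dist_norm)

lemma z_derivative_at_0:
  assumes b: "b \<in> {2,3,4}" and \<zeta>: "norm \<zeta> < r" and y: "norm y < r"
  shows "D b y (monomials_dz E 0 \<zeta>) =
    \<zeta> ^ b * (A y + B y (monomials_dz E 0 \<zeta>)) + of_nat b * \<zeta> ^ (b - 1) * Y \<zeta> y"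
proof -
  define m where "m = monomials_dz E 0 \<zeta>"
  have "((\<lambda>z. G b (y + monomials E z \<zeta>)) has_field_derivative D b y m) (at 0)"
    unfolding m_def
    by (rule has_field_derivative_along_monomials) (use b y G_deriv D_scale in auto)
  then have 1: "((\<lambda>z. G b (y + monomials E z \<zeta>) - G b y) has_field_derivative D b y m) (at 0)"
    by (auto intro!: derivative_eq_intros)
  have "((\<lambda>z. (z, y + monomials E z \<zeta>)) has_derivative (\<lambda>h. (h, h *s m))) (at 0)"
    unfolding m_def by (intro has_derivative_Pair has_derivative_ident has_derivative_monomials)
  from has_derivative_along[OF this Z_deriv[OF y]]
  have "((\<lambda>z. Z z (y + monomials E z \<zeta>)) has_derivative (\<lambda>h. A y * h + B y (h *s m))) (at 0)"
    by simp
  then have "((\<lambda>z. Z z (y + monomials E z \<zeta>)) has_field_derivative (A y + B y m)) (at 0)"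
    unfolding has_field_derivative_def
    by (rule has_derivative_eq_rhs) (simp add: fun_eq_iff B_scale[OF y] algebra_simps)
  then have 2: "((\<lambda>z. \<zeta> ^ b * (Z z (y + monomials E z \<zeta>) - Z 0 y) + of_nat b * z * \<zeta> ^ (b - 1) * Y \<zeta> y)
      has_field_derivative \<zeta> ^ b * (A y + B y m) + of_nat b * \<zeta> ^ (b - 1) * Y \<zeta> y) (at 0)"
    by (auto intro!: derivative_eq_intros)
  have ev: "\<forall>\<^sub>F z in nhds 0. G b (y + monomials E z \<zeta>) - G b y =
      \<zeta> ^ b * (Z z (y + monomials E z \<zeta>) - Z 0 y) + of_nat b * z * \<zeta> ^ (b - 1) * Y \<zeta> y"
    using near_0 by (rule eventually_mono) (rule system[OF b _ \<zeta> y])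
  show ?thesis
    using DERIV_cong_ev[OF refl ev refl] 1 2 DERIV_unique unfolding m_def by blast
qed

lemma zeta_derivative_at_0:
  assumes b: "b \<in> {2,3,4}" and z: "norm z < r" and y: "norm y < r"
  shows "D b y (monomials_dz (\<lambda>a b. E b a) 0 z) = (if b = 2 then 2 * z * Y 0 y else 0)"
proof -
  define S where "S \<zeta> = Z z (y + monomials E z \<zeta>) - Z 0 y" for \<zeta>
  have swap: "monomials E z \<zeta> = monomials (\<lambda>a b. E b a) \<zeta> z" for \<zeta>
    using monomials_swap[of E \<zeta> z] by simp
  have "isCont (\<lambda>\<zeta>. y + monomials E z \<zeta>) 0"
    unfolding swap by (rule has_derivative_continuous[OF has_derivative_monomials])
  then have S: "isCont S 0"
    unfolding S_def using Z_cont[OF z y]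
    by (intro continuous_diff continuous_const isCont_o2[of 0 "\<lambda>\<zeta>. y + monomials E z \<zeta>" "Z z"]) auto
  \<comment> \<open>Continuity of \<open>S\<close> is enough for this because \<open>b \<ge> 2\<close>.\<close>
  have "((\<lambda>\<zeta>. \<zeta> ^ b * S \<zeta>) has_field_derivative 0) (at 0)"
  proof -
    have "(\<lambda>\<zeta>. \<zeta> ^ (b - 1) * S \<zeta>) \<midarrow>0\<rightarrow> 0 ^ (b - 1) * S 0"
      using S by (intro tendsto_intros) (simp add: isCont_def)
    moreover have "0 ^ (b - 1) * S 0 = 0" using b by auto
    ultimately have lim: "(\<lambda>\<zeta>. \<zeta> ^ (b - 1) * S \<zeta>) \<midarrow>0\<rightarrow> 0" by (simp only:)
    have "\<forall>\<^sub>F \<zeta> in at 0. \<zeta> ^ (b - 1) * S \<zeta> = (\<zeta> ^ b * S \<zeta> - 0 ^ b * S 0) / (\<zeta> - 0)"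
      using b by (auto simp: eventually_at_filter power2_eq_square power3_eq_cube power4_eq_xxxx)
    from Lim_transform_eventually[OF lim this] show ?thesis
      unfolding has_field_derivative_iff .
  qed
  moreover have "((\<lambda>\<zeta>. of_nat b * z * \<zeta> ^ (b - 1) * Y \<zeta> y) has_field_derivative
      of_nat b * z * (of_nat (b - 1) * 0 ^ (b - 1 - 1)) * Y 0 y + of_nat b * z * 0 ^ (b - 1) * C y) (at 0)"
    using Y_deriv[OF y] by (auto intro!: derivative_eq_intros)
  ultimately have "((\<lambda>\<zeta>. \<zeta> ^ b * S \<zeta> + of_nat b * z * \<zeta> ^ (b - 1) * Y \<zeta> y) has_field_derivative
      0 + (of_nat b * z * (of_nat (b - 1) * 0 ^ (b - 1 - 1)) * Y 0 y + of_nat b * z * 0 ^ (b - 1) * C y)) (at 0)"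
    by (rule DERIV_add)
  then have 2: "((\<lambda>\<zeta>. \<zeta> ^ b * S \<zeta> + of_nat b * z * \<zeta> ^ (b - 1) * Y \<zeta> y) has_field_derivative
      (if b = 2 then 2 * z * Y 0 y else 0)) (at 0)"
    by (rule DERIV_cong) (use b in auto)
  have "((\<lambda>\<zeta>. G b (y + monomials E z \<zeta>)) has_field_derivative D b y (monomials_dz (\<lambda>a b. E b a) 0 z)) (at 0)"
    unfolding swap by (rule has_field_derivative_along_monomials) (use b y G_deriv D_scale in auto)
  then have 1: "((\<lambda>\<zeta>. G b (y + monomials E z \<zeta>) - G b y) has_field_derivative
      D b y (monomials_dz (\<lambda>a b. E b a) 0 z)) (at 0)"
    by (auto intro!: derivative_eq_intros)
  have ev: "\<forall>\<^sub>F \<zeta> in nhds 0. G b (y + monomials E z \<zeta>) - G b y =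
      \<zeta> ^ b * S \<zeta> + of_nat b * z * \<zeta> ^ (b - 1) * Y \<zeta> y"
    using near_0 unfolding S_def by (rule eventually_mono) (rule system[OF b z _ y])
  show ?thesis
    using DERIV_cong_ev[OF refl ev refl] 1 2 DERIV_unique by blast
qed

text \<open>The right-hand sides vanish to second order in \<open>\<zeta>\<close>, except for the term \<open>2 z \<zeta> Y\<close> when \<open>b = 2\<close>, which only
  concerns the direction \<open>E 1 1\<close>.\<close>

lemma D_directions_a1:
  assumes y: "norm y < r"
  shows "D 2 y (E 2 1) = 0" and "a \<in> {1,2,3,4} \<Longrightarrow> D 3 y (E a 1) = 0"
    and "a \<in> {1,2,3,4} \<Longrightarrow> D 4 y (E a 1) = 0"
proof -
  have *: "[:0, D b y (E 1 1) - (if b = 2 then 2 * Y 0 y else 0), D b y (E 2 1), D b y (E 3 1), D b y (E 4 1):] = 0"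
    if b: "b \<in> {2,3,4}" for b
    by (rule poly_zero_near_0[OF r_pos],
      insert zeta_derivative_at_0[OF b _ y] monomials_dz_expand[OF D_linear[OF b y] D_scale[OF b y], of "\<lambda>a b. E b a" 0])
     (simp add: algebra_simps eval_nat_numeral split: if_splits)
  show "D 2 y (E 2 1) = 0" using *[of 2] by simp
  show "a \<in> {1,2,3,4} \<Longrightarrow> D 3 y (E a 1) = 0" using *[of 3] by auto
  show "a \<in> {1,2,3,4} \<Longrightarrow> D 4 y (E a 1) = 0" using *[of 4] by auto
qed

text \<open>The monomial \<open>z\<^sup>2 \<zeta>\<^sup>2\<close> is invisible to first order at \<open>z = 0\<close> and at \<open>\<zeta> = 0\<close>. A combination of the three
  equations that is free of \<open>Z\<close> and \<open>Y\<close> can be differentiated at \<open>z \<noteq> 0\<close> and reaches it.\<close>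

lemma D_direction_22:
  assumes y: "norm y < r"
  shows "D 3 y (E 2 2) = 0" and "D 4 y (E 2 2) = 0"
proof -
  \<comment> \<open>The coefficients annihilate both unknowns: \<open>1 - 2 + 1 = 0\<close> for \<open>Z\<close> and \<open>2 - 6 + 4 = 0\<close> for \<open>Y\<close>.\<close>
  define K where "K \<zeta> v = \<zeta>^2 * G 2 v - 2 * \<zeta> * G 3 v + G 4 v" for \<zeta> v
  define T where "T \<zeta> v = \<zeta>^2 * D 2 y v - 2 * \<zeta> * D 3 y v + D 4 y v" for \<zeta> v
  have Tlin: "linear (T \<zeta>)" for \<zeta>
    unfolding T_def using D_linear[OF _ y]
    by (intro linearI) (simp_all add: linear_add linear_scale algebra_simps)
  have Tscale: "T \<zeta> (c *s v) = c * T \<zeta> v" for \<zeta> c v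
    unfolding T_def using D_scale[OF _ y] by (simp add: algebra_simps)
  have Kder: "(K \<zeta> has_derivative T \<zeta>) (at y)" for \<zeta>
    unfolding K_def T_def
    by (intro derivative_intros has_derivative_mult_right G_deriv[OF _ y]) simp_all
  have inv: "K \<zeta> (x + monomials E z \<zeta>) = K \<zeta> x" if "norm z < r" "norm \<zeta> < r" "norm x < r" for z \<zeta> x
  proof -
    define S where "S = Z z (x + monomials E z \<zeta>) - Z 0 x"
    have "K \<zeta> (x + monomials E z \<zeta>) - K \<zeta> x =
        \<zeta>^2 * (G 2 (x + monomials E z \<zeta>) - G 2 x) - 2 * \<zeta> * (G 3 (x + monomials E z \<zeta>) - G 3 x)
        + (G 4 (x + monomials E z \<zeta>) - G 4 x)"
      by (simp add: K_def algebra_simps)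
    also have "\<dots> = \<zeta>^2 * (\<zeta>^2 * S + 2 * z * \<zeta> * Y \<zeta> x) - 2 * \<zeta> * (\<zeta>^3 * S + 3 * z * \<zeta>^2 * Y \<zeta> x)
        + (\<zeta>^4 * S + 4 * z * \<zeta>^3 * Y \<zeta> x)"
      using system[of 2 z \<zeta> x] system[of 3 z \<zeta> x] system[of 4 z \<zeta> x] that by (simp add: S_def)
    also have "\<dots> = 0" by (simp add: algebra_simps eval_nat_numeral)
    finally show ?thesis by simp
  qed
  obtain \<delta> where d: "\<delta> > 0" "\<And>z \<zeta>. norm z < \<delta> \<Longrightarrow> norm \<zeta> < \<delta> \<Longrightarrow> T \<zeta> (monomials_dz E z \<zeta>) = 0"
    by (rule derivative_along_invariance[OF r_pos y Kder Tscale inv]) blast+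
  have "\<zeta> * T \<zeta> (E 2 1) + \<zeta>^2 * T \<zeta> (E 2 2) = 0" if "norm \<zeta> < \<delta>" for \<zeta>
    by (rule monomials_dz_coeffs(2)[OF Tlin Tscale d(1)]) (use d(2) that in simp)
  then have "\<zeta>^2 * T \<zeta> (E 2 2) = 0" if "norm \<zeta> < \<delta>" for \<zeta>
    using that D_directions_a1[OF y] by (simp add: T_def)
  then have "[:0, 0, D 4 y (E 2 2), - 2 * D 3 y (E 2 2), D 2 y (E 2 2):] = 0"
    by (intro poly_zero_near_0[OF d(1)]) (simp add: T_def algebra_simps eval_nat_numeral)
  then show "D 3 y (E 2 2) = 0" "D 4 y (E 2 2) = 0" by simp_all
qed

text \<open>Comparison of the powers of \<open>\<zeta>\<close> in the \<open>z\<close>-derivative at \<open>z = 0\<close>. The right-hand side starts with \<open>\<zeta>\<^bsup>b-1\<^esup>\<close>, whose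
  coefficient contains \<open>Y 0 y\<close>, and in the next power the derivatives \<open>A\<close> and \<open>C\<close> of the two unknowns meet.\<close>

lemma D_directions_1b:
  assumes y: "norm y < r"
  shows "D 3 y (E 1 2) = 3 * Y 0 y" "D 3 y (E 1 3) = A y + 3 * C y"
    and "D 4 y (E 1 2) = 0" "D 4 y (E 1 3) = 4 * Y 0 y" "D 4 y (E 1 4) = A y + 4 * C y"
proof -
  define q where "q \<zeta> = (Y \<zeta> y - Y 0 y) / \<zeta>" for \<zeta>
  have q: "(q \<longlongrightarrow> C y) (at 0)"
    using Y_deriv[OF y] unfolding has_field_derivative_iff q_def by simp
  have Yq: "Y \<zeta> y = Y 0 y + \<zeta> * q \<zeta>" if "\<zeta> \<noteq> 0" for \<zeta> using that by (simp add: q_def)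
  define L where "L T \<zeta> = \<zeta> * T (E 1 1) + \<zeta>^2 * T (E 1 2) + \<zeta>^3 * T (E 1 3) + \<zeta>^4 * T (E 1 4)" for T :: "complex^8 \<Rightarrow> complex" and \<zeta>
  have L0: "((\<lambda>\<zeta>. L T \<zeta>) \<longlongrightarrow> 0) (at 0)" for T
    unfolding L_def by (auto intro!: tendsto_eq_intros)
  have eq: "\<forall>\<^sub>F \<zeta> in at 0. L (D b y) \<zeta> = \<zeta> ^ b * (A y + L (B y) \<zeta>) + of_nat b * \<zeta> ^ (b - 1) * (Y 0 y + \<zeta> * q \<zeta>)"
    if b: "b \<in> {2,3,4}" for b
    unfolding eventually_at_filter using near_0
  proof (rule eventually_mono, intro impI)
    fix \<zeta> :: complex assume "norm \<zeta> < r" "\<zeta> \<noteq> 0"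
    then show "L (D b y) \<zeta> = \<zeta> ^ b * (A y + L (B y) \<zeta>) + of_nat b * \<zeta> ^ (b - 1) * (Y 0 y + \<zeta> * q \<zeta>)"
      using z_derivative_at_0[OF b _ y, of \<zeta>] 
        monomials_dz_expand[OF D_linear[OF b y] D_scale[OF b y], of E 0 \<zeta>]
        monomials_dz_expand[OF B_linear[OF y] B_scale[OF y], of E 0 \<zeta>] Yq[of \<zeta>]
      by (simp add: L_def)
  qed
  have 3: "D 3 y (E 1 1) = 0" and 4: "D 4 y (E 1 1) = 0" using D_directions_a1[OF y] by auto
  have lims: "((\<lambda>\<zeta>. f \<zeta> - (A y + L (B y) \<zeta>) - c * q \<zeta>) \<longlongrightarrow> l - A y - c * C y) (at 0)"
    if "(f \<longlongrightarrow> l) (at 0)" for f l c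
    using that by (auto intro!: tendsto_eq_intros L0 q)
  let ?f3 = "\<lambda>\<zeta>. D 3 y (E 1 3) + \<zeta> * D 3 y (E 1 4) - (A y + L (B y) \<zeta>) - 3 * q \<zeta>"
  have l3: "(?f3 \<longlongrightarrow> D 3 y (E 1 3) - A y - 3 * C y) (at 0)"
    by (rule lims) (auto intro!: tendsto_eq_intros)
  have "\<forall>\<^sub>F \<zeta> in at 0. (D 3 y (E 1 2) - 3 * Y 0 y) + \<zeta> * ?f3 \<zeta> = 0"
    using eq[of 3, simplified] eventually_neq_at_within[of 0]
  proof eventually_elim
    case (elim \<zeta>)
    then have "\<zeta>^2 * ((D 3 y (E 1 2) - 3 * Y 0 y) + \<zeta> * ?f3 \<zeta>) = 0"
      unfolding L_def[of "D 3 y"] 3 by algebra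
    then show ?case using elim by simp
  qed
  note r3 = peel_constant_term[OF this l3]
  then show "D 3 y (E 1 2) = 3 * Y 0 y" "D 3 y (E 1 3) = A y + 3 * C y"
    by (simp_all add: algebra_simps)
  let ?f4 = "\<lambda>\<zeta>. D 4 y (E 1 4) - (A y + L (B y) \<zeta>) - 4 * q \<zeta>"
  let ?g4 = "\<lambda>\<zeta>. (D 4 y (E 1 3) - 4 * Y 0 y) + \<zeta> * ?f4 \<zeta>"
  have l4: "(?f4 \<longlongrightarrow> D 4 y (E 1 4) - A y - 4 * C y) (at 0)"
    by (rule lims) (auto intro!: tendsto_eq_intros)
  have "(?g4 \<longlongrightarrow> (D 4 y (E 1 3) - 4 * Y 0 y) + 0 * (D 4 y (E 1 4) - A y - 4 * C y)) (at 0)"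
    by (intro tendsto_intros l4)
  then have m4: "(?g4 \<longlongrightarrow> D 4 y (E 1 3) - 4 * Y 0 y) (at 0)" by simp
  have "\<forall>\<^sub>F \<zeta> in at 0. D 4 y (E 1 2) + \<zeta> * ?g4 \<zeta> = 0"
    using eq[of 4, simplified] eventually_neq_at_within[of 0]
  proof eventually_elim
    case (elim \<zeta>)
    then have "\<zeta>^2 * (D 4 y (E 1 2) + \<zeta> * ?g4 \<zeta>) = 0"
      unfolding L_def[of "D 4 y"] 4 by algebra
    then show ?case using elim by simp
  qed
  note r4 = peel_constant_term[OF this m4]
  note s4 = peel_constant_term[OF conjunct1[OF conjunct2[OF r4]] l4]
  show "D 4 y (E 1 2) = 0" "D 4 y (E 1 3) = 4 * Y 0 y" "D 4 y (E 1 4) = A y + 4 * C y"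
    using r4 s4 by (simp_all add: algebra_simps)
qed

lemma G_inv:
  assumes "b \<in> {2,3,4}" "\<And>y. norm y < r \<Longrightarrow> D b y e = 0"
  shows "inv_along r e (G b)"
  by (rule inv_along_zero_derivative[OF G_deriv[OF assms(1)] D_scale[OF assms(1)] assms(2)])

lemma D_inv: "b \<in> {2,3,4} \<Longrightarrow> inv_along r e (G b) \<Longrightarrow> inv_along r e (\<lambda>y. D b y v)"
  by (rule inv_along_derivative[OF _ G_deriv])

lemma inv_along_combine:
  assumes "inv_along r e f" "inv_along r e g" and "\<And>y. norm y < r \<Longrightarrow> h y = F (f y) (g y)"
  shows "inv_along r e h"
  using assms unfolding inv_along_def by simp

lemma D_vanishing_directions:
  assumes "e \<in> {E 1 1, E 2 1, E 3 1, E 4 1, E 2 2}" "norm y < r"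
  shows "D 3 y e = 0" "D 4 y e = 0"
  using D_directions_a1[OF assms(2)] D_direction_22[OF assms(2)] assms(1) by auto

text \<open>\<open>Y 0\<close>, \<open>A + 3 C\<close> and \<open>A + 4 C\<close> are, up to a numerical factor, derivatives of \<open>G 3\<close> and \<open>G 4\<close>, which are constant along the directions
  where their derivatives vanish; the two sums determine \<open>A\<close> and \<open>C\<close>.\<close>

lemma initial_data_inv:
  assumes e: "e \<in> {E 1 1, E 2 1, E 3 1, E 4 1, E 2 2}"
  shows "inv_along r e (Y 0)" "inv_along r e A" "inv_along r e C"
proof -
  have 3: "inv_along r e (\<lambda>y. D 3 y v)" for v
    by (rule D_inv[OF _ G_inv]) (use D_vanishing_directions[OF e] in auto)
  have 4: "inv_along r e (\<lambda>y. D 4 y v)" for v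
    by (rule D_inv[OF _ G_inv]) (use D_vanishing_directions[OF e] in auto)
  show "inv_along r e (Y 0)"
    by (rule inv_along_combine[OF 4[of "E 1 3"] 4[of "E 1 3"], where F = "\<lambda>x y. x / 4"]) (simp add: D_directions_1b del: One_nat_def)
  show "inv_along r e A"
    by (rule inv_along_combine[OF 3[of "E 1 3"] 4[of "E 1 4"], where F = "\<lambda>x y. 4 * x - 3 * y"]) (simp add: D_directions_1b del: One_nat_def)
  show "inv_along r e C"
    by (rule inv_along_combine[OF 3[of "E 1 3"] 4[of "E 1 4"], where F = "\<lambda>x y. y - x"]) (simp add: D_directions_1b del: One_nat_def)
qed

text \<open>When \<open>A\<close> and \<open>C\<close> vanish, \<open>G 4\<close> is also constant along \<open>E 1 2\<close> and \<open>E 1 4\<close>, and \<open>G 3\<close> along \<open>E 1 3\<close>. Since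
  \<open>Y 0\<close> is a derivative of each of them, it is constant along these directions.\<close>

lemma Y_inv:
  assumes AC: "\<And>y. norm y < r \<Longrightarrow> A y = 0" "\<And>y. norm y < r \<Longrightarrow> C y = 0"
    and e: "e \<in> (\<lambda>(a, b). E a b) ` exps"
  shows "inv_along r e (Y 0)"
proof -
  have 3: "inv_along r (E 1 3) (\<lambda>y. D 3 y v)" for v
    by (rule D_inv[OF _ G_inv]) (use D_directions_1b AC in auto)
  have 4: "inv_along r (E 1 b) (\<lambda>y. D 4 y v)" if "b \<in> {2, 4}" for v b
    by (rule D_inv[OF _ G_inv]) (use D_directions_1b AC that in auto)
  have "inv_along r (E 1 3) (Y 0)"
    by (rule inv_along_combine[OF 3[of "E 1 2"] 3[of "E 1 2"], where F = "\<lambda>x y. x / 3"]) (simp add: D_directions_1b del: One_nat_def)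
  moreover have "inv_along r (E 1 b) (Y 0)" if "b \<in> {2, 4}" for b
    by (rule inv_along_combine[OF 4[OF that, of "E 1 3"] 4[OF that, of "E 1 3"], where F = "\<lambda>x y. x / 4"]) (simp add: D_directions_1b del: One_nat_def)
  ultimately show ?thesis using e initial_data_inv(1)[of e] by (auto simp: exps_def)
qed

lemma G4_inv:
  assumes AC: "\<And>y. norm y < r \<Longrightarrow> A y = 0" "\<And>y. norm y < r \<Longrightarrow> C y = 0"
    and "\<And>y. norm y < r \<Longrightarrow> Y 0 y = 0" and e: "e \<in> (\<lambda>(a, b). E a b) ` exps"
  shows "inv_along r e (G 4)"
proof (rule G_inv)
  fix y :: "complex^8" assume y: "norm y < r"
  show "D 4 y e = 0" using D_vanishing_directions(2)[of e y] D_directions_1b[OF y] assms(1,2,3)[OF y] e y by (auto simp: exps_def)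
qed simp

end

section \<open>Rigidity of the complexified equations\<close>

lemma exhaust_8: "k = 1 \<or> k = 2 \<or> k = 3 \<or> k = 4 \<or> k = 5 \<or> k = 6 \<or> k = 7 \<or> k = 8" for k :: 8
proof (induct k)
  case (of_int z)
  then have "0 \<le> z" "z < 8" by simp_all
  then have "z = 0 \<or> z = 1 \<or> z = 2 \<or> z = 3 \<or> z = 4 \<or> z = 5 \<or> z = 6 \<or> z = 7" by arith
  moreover have "(0::8) = 8" by simp
  ultimately show ?case by auto
qed

lemma forall_8: "(\<forall>k::8. P k) \<longleftrightarrow> P 1 \<and> P 2 \<and> P 3 \<and> P 4 \<and> P 5 \<and> P 6 \<and> P 7 \<and> P 8"
proof (intro iffI allI)
  fix k assume "P 1 \<and> P 2 \<and> P 3 \<and> P 4 \<and> P 5 \<and> P 6 \<and> P 7 \<and> P 8"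
  then show "P k" using exhaust_8[of k] by auto
qed simp

text \<open>The position of \<open>y\<^sub>a\<^sub>b\<close>. The order of the pairs makes each \<open>w\<^sup>k\<close> a combination of the coordinate in
  position \<open>k\<close> and, for a complex conjugate pair of exponents, a neighbouring one.\<close>

definition slot :: "nat \<Rightarrow> nat \<Rightarrow> 8"
  where "slot a b = (if (a, b) = (1, 1) then 1 else if (a, b) = (2, 1) then 2 else if (a, b) = (1, 2) then 3
    else if (a, b) = (3, 1) then 4 else if (a, b) = (1, 3) then 5 else if (a, b) = (2, 2) then 6
    else if (a, b) = (4, 1) then 7 else 8)"

abbreviation ax :: "nat \<Rightarrow> nat \<Rightarrow> complex^8" where "ax a b \<equiv> axis (slot a b) 1"

lemma slot_simps:
  "slot 1 1 = 1" "slot 2 1 = 2" "slot 1 2 = 3" "slot 3 1 = 4" "slot 1 3 = 5" "slot 2 2 = 6" "slot 4 1 = 7" "slot 1 4 = 8"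
  by (simp_all add: slot_def)

lemma slot_cases:
  obtains a b where "(a, b) \<in> exps" "k = slot a b"
proof -
  have "k = slot 1 1 \<or> k = slot 2 1 \<or> k = slot 1 2 \<or> k = slot 3 1 \<or> k = slot 1 3 \<or> k = slot 2 2
      \<or> k = slot 4 1 \<or> k = slot 1 4"
    unfolding slot_simps by (rule exhaust_8)
  moreover have "(1, 1) \<in> exps" "(2, 1) \<in> exps" "(1, 2) \<in> exps" "(3, 1) \<in> exps" "(1, 3) \<in> exps"
    "(2, 2) \<in> exps" "(4, 1) \<in> exps" "(1, 4) \<in> exps"
    by (simp_all add: exps_def)
  ultimately show thesis using that by blast
qed

lemma exps_swap: "(a, b) \<in> exps \<Longrightarrow> (b, a) \<in> exps"
  by (auto simp: exps_def)

text \<open>The uniqueness statement behind the bound on the dimension: initial values of \<open>Z\<close>, \<open>\<partial>\<^sub>z Z\<close>, their reflected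
  counterparts and \<open>V\<close> at the origin determine the solution.\<close>

lemma rigidity_of_complexified_system:
  fixes Z Z' :: "complex \<Rightarrow> complex^8 \<Rightarrow> complex" and V V' :: "complex \<Rightarrow> complex^8 \<Rightarrow> complex^8"
  assumes R: "R > 0"
    and Zd: "\<And>y. norm y < R \<Longrightarrow> ((\<lambda>(z, v). Z z v) has_derivative (\<lambda>(h, v). A y * h + B y v)) (at (0, y))"
    and B: "\<And>y. norm y < R \<Longrightarrow> linear (B y)" "\<And>y c v. norm y < R \<Longrightarrow> B y (c *s v) = c * B y v"
    and Zc: "\<And>z y. norm z < R \<Longrightarrow> norm y < R \<Longrightarrow> isCont (Z z) y"
    and Zd': "\<And>y. norm y < R \<Longrightarrow> ((\<lambda>(z, v). Z' z v) has_derivative (\<lambda>(h, v). A' y * h + B' y v)) (at (0, y))"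
    and B': "\<And>y. norm y < R \<Longrightarrow> linear (B' y)" "\<And>y c v. norm y < R \<Longrightarrow> B' y (c *s v) = c * B' y v"
    and Zc': "\<And>z y. norm z < R \<Longrightarrow> norm y < R \<Longrightarrow> isCont (Z' z) y"
    and Vd: "\<And>y. norm y < R \<Longrightarrow> (V 0 has_derivative DV y) (at y)"
    and DV: "\<And>y c v. norm y < R \<Longrightarrow> DV y (c *s v) = c *s DV y v"
    and eq: "\<And>z \<zeta> y a b. norm z < R \<Longrightarrow> norm \<zeta> < R \<Longrightarrow> norm y < R \<Longrightarrow> (a, b) \<in> exps \<Longrightarrow>
      V z (y + monomials ax z \<zeta>) $ slot a b - V' \<zeta> y $ slot a b =
        of_nat a * z ^ (a - 1) * \<zeta> ^ b * Z z (y + monomials ax z \<zeta>) + of_nat b * z ^ a * \<zeta> ^ (b - 1) * Z' \<zeta> y"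
    and init: "Z 0 0 = 0" "Z' 0 0 = 0" "A 0 = 0" "A' 0 = 0" "V 0 0 = 0"
  obtains \<delta> where "\<delta> > 0" "\<And>z y. norm z < \<delta> \<Longrightarrow> norm y < \<delta> \<Longrightarrow> Z z y = 0 \<and> V z y = 0"
proof -
  obtain \<rho> where \<rho>: "\<rho> > 0" and \<rho>': "\<And>z \<zeta>. norm z < \<rho> \<Longrightarrow> norm \<zeta> < \<rho> \<Longrightarrow> norm (monomials ax z \<zeta>) < R / 2"
    using monomials_small[of "R / 2" ax] R by auto
  define r where "r = min \<rho> (R / 2)"
  have r: "r > 0" "r < R" using \<rho> R by (auto simp: r_def)
  have shift: "norm (y + monomials ax z \<zeta>) < R" "norm (y - monomials ax z \<zeta>) < R"
    if "norm z < r" "norm \<zeta> < r" "norm y < r" for z \<zeta> y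
    using \<rho>'[of z \<zeta>] that norm_triangle_ineq[of y "monomials ax z \<zeta>"] norm_triangle_ineq4[of y "monomials ax z \<zeta>"]
    by (auto simp: r_def)
  have ab_pos: "a > 0" "b > 0" if "(a, b) \<in> exps" for a b using that by (auto simp: exps_def)
  have V00: "V 0 y = V' 0 y" if "norm y < R" for y
  proof -
    have "V 0 y $ k = V' 0 y $ k" for k
    proof -
      obtain a b where k: "(a, b) \<in> exps" "k = slot a b" by (rule slot_cases)
      show ?thesis using eq[OF _ _ that k(1), of 0 0] R ab_pos[OF k(1)] by (simp add: k(2) zero_power)
    qed
    then show ?thesis by (simp add: vec_eq_iff)
  qed
  have Vz: "V z y $ slot a b = V 0 y $ slot a b + of_nat b * z ^ a * 0 ^ (b - 1) * Z' 0 y"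
    if "norm z < R" "norm y < R" "(a, b) \<in> exps" for z y a b
    using eq[OF that(1) _ that(2,3), of 0] R ab_pos[OF that(3)] V00[OF that(2)] by (simp add: zero_power algebra_simps)
  have Vz': "V' \<zeta> y $ slot a b = V 0 y $ slot a b - of_nat a * 0 ^ (a - 1) * \<zeta> ^ b * Z 0 y"
    if "norm \<zeta> < R" "norm y < R" "(a, b) \<in> exps" for \<zeta> y a b
    using eq[OF _ that(1,2,3), of 0] R ab_pos[OF that(3)] by (simp add: zero_power algebra_simps)
  have curve: "((\<lambda>\<zeta>. F \<zeta> y) has_field_derivative a) (at 0)"
    if "((\<lambda>(z, v). F z v) has_derivative (\<lambda>(h, v). a * h + T v)) (at (0, y))" "linear T"
    for F :: "complex \<Rightarrow> complex^8 \<Rightarrow> complex" and y a T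
  proof -
    have "((\<lambda>\<zeta>. (\<zeta>, y)) has_derivative (\<lambda>h. (h, 0))) (at (0::complex))"
      by (auto intro!: derivative_eq_intros)
    from has_derivative_along[OF this that(1)] show ?thesis
      using linear_0[OF that(2)] by (simp add: has_field_derivative_def)
  qed
  have comp: "((\<lambda>y. V 0 y $ k) has_derivative (\<lambda>v. DV y v $ k)) (at y)" if "norm y < R" for y k
    using Vd[OF that] by (rule bounded_linear.has_derivative[OF bounded_linear_vec_nth])
  interpret P: half_system r ax "\<lambda>b y. V 0 y $ slot 1 b" "\<lambda>b y v. DV y v $ slot 1 b" Z Z' A A' B
  proof
    fix b :: nat and z \<zeta> :: complex and y :: "complex^8"
    assume b: "b \<in> {2, 3, 4}" and z: "norm z < r" "norm \<zeta> < r" and y: "norm y < r"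
    have e: "(1, b) \<in> exps" using b by (auto simp: exps_def)
    show "V 0 (y + monomials ax z \<zeta>) $ slot 1 b - V 0 y $ slot 1 b =
       \<zeta> ^ b * (Z z (y + monomials ax z \<zeta>) - Z 0 y) + of_nat b * z * \<zeta> ^ (b - 1) * Z' \<zeta> y"
    proof -
      have e1: "V z (y + monomials ax z \<zeta>) $ slot 1 b = V 0 (y + monomials ax z \<zeta>) $ slot 1 b"
        using Vz[OF _ _ e, of z "y + monomials ax z \<zeta>"] shift(1)[OF z y] r z b by auto
      have e2: "V' \<zeta> y $ slot 1 b = V 0 y $ slot 1 b - \<zeta> ^ b * Z 0 y"
        using Vz'[OF _ _ e, of \<zeta> y] r z y by simp
      have "V z (y + monomials ax z \<zeta>) $ slot 1 b - V' \<zeta> y $ slot 1 b =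
          \<zeta> ^ b * Z z (y + monomials ax z \<zeta>) + of_nat b * z * \<zeta> ^ (b - 1) * Z' \<zeta> y"
        using eq[OF _ _ _ e, of z \<zeta> y] r z y by simp
      then show ?thesis unfolding e1 e2 by (simp add: algebra_simps)
    qed
  qed (use r Zd B B(1)[THEN linear_add] B(1)[THEN linear_scale] Zc DV comp curve[OF Zd' B'(1)] in auto)
  \<comment> \<open>Here \<open>z\<close> and \<open>\<zeta>\<close> exchange roles and the base point is \<open>y\<close> in place of \<open>y'\<close>,
    which reverses the sign of the directions and of \<open>G\<close>.\<close>
  interpret Q: half_system r "\<lambda>a b. - ax b a" "\<lambda>b y. - V 0 y $ slot b 1" "\<lambda>b y v. - DV y v $ slot b 1"
     Z' Z A' A B'
  proof
    fix b :: nat and z \<zeta> :: complex and y :: "complex^8"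
    assume b: "b \<in> {2, 3, 4}" and z: "norm z < r" "norm \<zeta> < r" and y: "norm y < r"
    have e: "(b, 1) \<in> exps" using b by (auto simp: exps_def)
    define y' where "y' = y - monomials ax \<zeta> z"
    have m: "y + monomials (\<lambda>a b. - ax b a) z \<zeta> = y'" 
      using monomials_uminus[of "\<lambda>a b. ax b a" z \<zeta>] monomials_swap[of ax z \<zeta>] by (simp add: y'_def)
    have yy: "y' + monomials ax \<zeta> z = y" by (simp add: y'_def)
    show "- V 0 (y + monomials (\<lambda>a b. - ax b a) z \<zeta>) $ slot b 1 - - V 0 y $ slot b 1 =
       \<zeta> ^ b * (Z' z (y + monomials (\<lambda>a b. - ax b a) z \<zeta>) - Z' 0 y) + of_nat b * z * \<zeta> ^ (b - 1) * Z \<zeta> y"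
    proof -
      have y': "norm y' < R" using shift(2)[OF z(2,1) y] by (simp add: y'_def)
      have e1: "V \<zeta> y $ slot b 1 = V 0 y $ slot b 1 + \<zeta> ^ b * Z' 0 y"
        using Vz[OF _ _ e, of \<zeta> y] r z y by simp
      have e2: "V' z y' $ slot b 1 = V 0 y' $ slot b 1"
        using Vz'[OF _ y' e, of z] r z b by auto
      have "V \<zeta> y $ slot b 1 - V' z y' $ slot b 1 =
          of_nat b * \<zeta> ^ (b - 1) * z * Z \<zeta> y + \<zeta> ^ b * Z' z y'"
        using eq[OF _ _ y' e, of \<zeta> z, unfolded yy] r z by simp
      then show ?thesis unfolding m e1 e2 by (simp add: algebra_simps)
    qed
  qed (use r Zd' B' B'(1)[THEN linear_add] B'(1)[THEN linear_scale] Zc' DV has_derivative_minus[OF comp] curve[OF Zd B(1)] in auto)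
  have Q_dir: "inv_along r (ax a b) f" if "inv_along r (- ax a b) f" for f a b
    using that by (rule inv_along_uminus)
  have all_dirs: "f y = f 0" if "\<And>a b. (a, b) \<in> exps \<Longrightarrow> inv_along r (ax a b) f" "norm y < r"
    for f :: "complex^8 \<Rightarrow> complex" and y
  proof (rule inv_along_axes_constant[OF _ that(2)])
    fix j :: 8
    obtain a b where "(a, b) \<in> exps" "j = slot a b" by (rule slot_cases)
    then show "inv_along r (axis j 1) f" using that(1) by simp
  qed
  have A_inv: "inv_along r (ax a b) A" if "(a, b) \<in> exps" for a b
    using that P.initial_data_inv(2)[of "ax a b"] Q_dir[OF Q.initial_data_inv(3)[of "- ax a b"]]
    unfolding exps_def by auto
  have A'_inv: "inv_along r (ax a b) A'" if "(a, b) \<in> exps" for a b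
    using that P.initial_data_inv(3)[of "ax a b"] Q_dir[OF Q.initial_data_inv(2)[of "- ax a b"]]
    unfolding exps_def by auto
  have A0: "A y = 0" "A' y = 0" if "norm y < r" for y
    using all_dirs[OF A_inv that] all_dirs[OF A'_inv that] init by auto
  have Z'0: "Z' 0 y = 0" if "norm y < r" for y
    using all_dirs[OF P.Y_inv[OF A0] that] init by force
  have "inv_along r (ax a b) (Z 0)" if "(a, b) \<in> exps" for a b
    by (rule Q_dir[OF Q.Y_inv[OF A0(2,1)]]) (use exps_swap[OF that] in force)+
  then have Z0: "Z 0 y = 0" if "norm y < r" for y
    using all_dirs[OF _ that, of "Z 0"] init by auto
  have G: "V 0 y $ slot 1 4 = V 0 0 $ slot 1 4" if "norm y < r" for y
    by (rule all_dirs[OF P.G4_inv[OF A0 Z'0] that]) force+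
  have "inv_along r (ax a b) (\<lambda>y. - V 0 y $ slot 4 1)" if "(a, b) \<in> exps" for a b
    by (rule Q_dir[OF Q.G4_inv[OF A0(2,1) Z0]]) (use exps_swap[OF that] in force)+
  then have G': "V 0 y $ slot 4 1 = V 0 0 $ slot 4 1" if "norm y < r" for y
    using all_dirs[OF _ that, of "\<lambda>y. - V 0 y $ slot 4 1"] by auto
  have both: "Z z (y + monomials ax z \<zeta>) = 0 \<and> Z' \<zeta> y = 0"
    if z: "norm z < r" "z \<noteq> 0" and \<zeta>: "norm \<zeta> < r" "\<zeta> \<noteq> 0" and y: "norm y < r" "norm (y + monomials ax z \<zeta>) < r"
    for z \<zeta> y
  proof -
    define u where "u = Z z (y + monomials ax z \<zeta>)"
    define u' where "u' = Z' \<zeta> y"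
    have m: "(y + monomials ax z \<zeta>) + monomials (\<lambda>a b. - ax b a) \<zeta> z = y"
      using monomials_uminus[of "\<lambda>a b. ax b a" \<zeta> z] monomials_swap[of ax \<zeta> z] by simp
    have "\<zeta> ^ 3 * (\<zeta> * u + 4 * z * u') = 0"
      using P.system[of 4 z \<zeta> y] z \<zeta> y G[OF y(1)] G[OF y(2)] Z0[OF y(1)]
      by (simp add: u_def u'_def algebra_simps eval_nat_numeral)
    then have 1: "\<zeta> * u + 4 * z * u' = 0" using \<zeta> by simp
    have "z ^ 3 * (z * u' + 4 * \<zeta> * u) = 0"
      using Q.system[of 4 \<zeta> z "y + monomials ax z \<zeta>", unfolded m] z \<zeta> y G'[OF y(1)] G'[OF y(2)] Z'0[OF y(2)]
      by (simp add: u_def u'_def algebra_simps eval_nat_numeral)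
    then have 2: "z * u' + 4 * \<zeta> * u = 0" using z by simp
    \<comment> \<open>The equations \<open>\<zeta> u + 4 z u' = 0\<close> and \<open>4 \<zeta> u + z u' = 0\<close> have determinant \<open>1 - 16\<close>.\<close>
    have "15 * (\<zeta> * u) = 4 * (z * u' + 4 * \<zeta> * u) - (\<zeta> * u + 4 * z * u')" by (simp add: algebra_simps)
    then have "u = 0" using 1 2 \<zeta> by simp
    then show ?thesis using 2 z by (simp add: u_def u'_def)
  qed
  obtain \<sigma> where \<sigma>: "\<sigma> > 0" and \<sigma>': "\<And>z \<zeta>. norm z < \<sigma> \<Longrightarrow> norm \<zeta> < \<sigma> \<Longrightarrow> norm (monomials ax z \<zeta>) < r / 2"
    using monomials_small[of "r / 2" ax] r by auto
  define s where "s = min \<sigma> (r / 2)"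
  have s: "s > 0" "s < r" using \<sigma> r by (auto simp: s_def)
  have shift': "norm (y + monomials ax z \<zeta>) < r" "norm (y - monomials ax z \<zeta>) < r"
    if "norm z < s" "norm \<zeta> < s" "norm y < s" for z \<zeta> y
    using \<sigma>'[of z \<zeta>] that norm_triangle_ineq[of y "monomials ax z \<zeta>"] norm_triangle_ineq4[of y "monomials ax z \<zeta>"]
    by (auto simp: s_def)
  \<comment> \<open>Any small nonzero value of the second variable can be used to reach a point \<open>(z, y)\<close>.\<close>
  define c where "c = complex_of_real (s / 2)"
  have c: "norm c < s" "c \<noteq> 0" using s by (auto simp: c_def)
  have Zz: "Z z y = 0" if "norm z < s" "norm y < s" for z y
  proof (cases "z = 0")
    case True then show ?thesis using Z0 that s by simp
  next
    case False
    show ?thesis using both[of z c "y - monomials ax z c"] shift'(2)[OF that(1) c(1) that(2)] c that s False by simp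
  qed
  have Zz': "Z' \<zeta> y = 0" if "norm \<zeta> < s" "norm y < s" for \<zeta> y
  proof (cases "\<zeta> = 0")
    case True then show ?thesis using Z'0 that s by simp
  next
    case False
    show ?thesis using both[of c \<zeta> y] shift'(1)[OF c(1) that] c that s False by simp
  qed
  have Vconst: "V z y = V 0 y" if "norm z < s" "norm y < s" for z y
  proof -
    have "V z y $ k = V 0 y $ k" for k
    proof -
      obtain a b where k: "(a, b) \<in> exps" "k = slot a b" by (rule slot_cases)
      show ?thesis using Vz[OF _ _ k(1), of z y] Zz'[of 0 y] that s r k(2) by simp
    qed
    then show ?thesis by (simp add: vec_eq_iff)
  qed
  have Vconst': "V' \<zeta> y = V 0 y" if "norm \<zeta> < s" "norm y < s" for \<zeta> y
  proof -
    have "V' \<zeta> y $ k = V 0 y $ k" for k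
    proof -
      obtain a b where k: "(a, b) \<in> exps" "k = slot a b" by (rule slot_cases)
      show ?thesis using Vz'[OF _ _ k(1), of \<zeta> y] Zz[of 0 y] that s r k(2) by simp
    qed
    then show ?thesis by (simp add: vec_eq_iff)
  qed
  obtain \<tau> where \<tau>: "\<tau> > 0" and \<tau>': "\<And>z \<zeta>. norm z < \<tau> \<Longrightarrow> norm \<zeta> < \<tau> \<Longrightarrow> norm (monomials ax z \<zeta>) < s / 2"
    using monomials_small[of "s / 2" ax] s by auto
  define \<delta> where "\<delta> = min \<tau> (s / 2)"
  have \<delta>: "\<delta> > 0" "\<delta> < s" using \<tau> s by (auto simp: \<delta>_def)
  have Vinv: "V 0 (y + monomials ax z \<zeta>) $ k = V 0 y $ k"
    if z: "norm z < \<delta>" and \<zeta>: "norm \<zeta> < \<delta>" and y: "norm y < \<delta>" for z \<zeta> y k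
  proof -
    have m: "norm (y + monomials ax z \<zeta>) < s"
      using \<tau>'[of z \<zeta>] that norm_triangle_ineq[of y "monomials ax z \<zeta>"] by (auto simp: \<delta>_def)
    obtain a b where k: "(a, b) \<in> exps" "k = slot a b" by (rule slot_cases)
    have "V z (y + monomials ax z \<zeta>) $ k - V' \<zeta> y $ k = 0"
      using eq[OF _ _ _ k(1), of z \<zeta> y] Zz[of z, OF _ m] Zz'[of \<zeta> y] z \<zeta> y \<delta> s r k(2) by simp
    then show ?thesis using Vconst[OF _ m, of z] Vconst'[of \<zeta> y] z \<zeta> y \<delta> by simp
  qed
  have "inv_along \<delta> (ax a b) (\<lambda>y. V 0 y $ k)" if ab: "(a, b) \<in> exps" for a b k
  proof (rule inv_along_zero_derivative)
    fix y :: "complex^8" assume y: "norm y < \<delta>"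
    then have yR: "norm y < R" using \<delta> s r by simp
    show d: "((\<lambda>y. V 0 y $ k) has_derivative (\<lambda>v. DV y v $ k)) (at y)" by (rule comp[OF yR])
    show sc: "DV y (c *s v) $ k = c * DV y v $ k" for c v using DV[OF yR] by simp
    obtain \<epsilon> where e: "\<epsilon> > 0" "\<And>z \<zeta>. norm z < \<epsilon> \<Longrightarrow> norm \<zeta> < \<epsilon> \<Longrightarrow> DV y (monomials_dz ax z \<zeta>) $ k = 0"
      by (rule derivative_along_invariance[where f = "\<lambda>_ y. V 0 y $ k" and T = "\<lambda>_ v. DV y v $ k" and E = ax,
          OF \<delta>(1) y d sc Vinv]) blast+
    show "DV y (ax a b) $ k = 0"
      by (rule clinear_zero_on_basis[OF has_derivative_linear[OF d] sc e ab])
  qed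
  note * = this
  have **: "V 0 y $ k = V 0 0 $ k" if "norm y < \<delta>" for y k
  proof (rule inv_along_axes_constant[OF _ that])
    fix j :: 8
    obtain a b where "(a, b) \<in> exps" "j = slot a b" by (rule slot_cases)
    then show "inv_along \<delta> (axis j 1) (\<lambda>y. V 0 y $ k)" using * by simp
  qed
  have "V 0 y = 0" if "norm y < \<delta>" for y
    unfolding vec_eq_iff using **[OF that] init(5) by simp
  note V0_zero = this
  show thesis
  proof (rule that[OF \<delta>(1)])
    fix z :: complex and y :: "complex^8" assume "norm z < \<delta>" "norm y < \<delta>"
    then show "Z z y = 0 \<and> V z y = 0"
      using Zz[of z y] Vconst[of z y] V0_zero[of y] \<delta>(2) by simp
  qed
qed

section \<open>Complexification of the tangency condition\<close>

lemma sum_8: "(\<Sum>k\<in>UNIV. f k) = f 1 + f 2 + f 3 + f 4 + f 5 + f 6 + f 7 + f (8::8)"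
  for f :: "8 \<Rightarrow> 'a::comm_monoid_add"
proof -
  have "(UNIV :: 8 set) = {1,2,3,4,5,6,7,8}" using exhaust_8 by auto
  show ?thesis unfolding \<open>UNIV = _\<close> by (simp add: add.assoc)
qed

lemma bounded_linear_smult_right: "bounded_linear (\<lambda>v::complex^8. c *s v)"
  by (intro linear_conv_bounded_linear[THEN iffD1] linearI)
    (simp_all add: vec_eq_iff algebra_simps)

text \<open>The antilinear involution for which the model is \<open>y - conj_swap y = (z\<^sup>a (cnj z)\<^sup>b)\<close>: it sends \<open>y\<^sub>a\<^sub>b\<close> to
  \<open>- cnj y\<^sub>b\<^sub>a\<close>, and corresponds to complex conjugation of \<open>w\<close>.\<close>

definition conj_swap :: "complex^8 \<Rightarrow> complex^8"
  where "conj_swap y = vector [- cnj (y$1), - cnj (y$3), - cnj (y$2), - cnj (y$5), - cnj (y$4), - cnj (y$6),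
    - cnj (y$8), - cnj (y$7)]"

lemma conj_swap_slot: "(a, b) \<in> exps \<Longrightarrow> conj_swap y $ slot a b = - cnj (y $ slot b a)"
  unfolding exps_def conj_swap_def
  by (elim insertE emptyE Pair_inject; simp add: slot_simps vector_8 del: One_nat_def)

lemma vec_eq_slots: "x = y \<longleftrightarrow> (\<forall>(a, b)\<in>exps. x $ slot a b = y $ slot a b)" for x y :: "complex^8"
  unfolding vec_eq_iff forall_8 by (auto simp add: exps_def slot_simps simp del: One_nat_def)

lemma conj_swap_add: "conj_swap (x + y) = conj_swap x + conj_swap y"
  and conj_swap_scale: "conj_swap (c *s x) = cnj c *s conj_swap x"
  and conj_swap_conj_swap: "conj_swap (conj_swap x) = x"
  and conj_swap_0 [simp]: "conj_swap 0 = 0"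
  by (simp_all add: conj_swap_def vec_eq_iff forall_8 vector_8)

lemma norm_conj_swap [simp]: "norm (conj_swap y) = norm y"
  unfolding norm_vec_def L2_set_def sum_8 by (simp add: conj_swap_def vector_8)

lemma linear_conj_swap: "linear conj_swap"
  by (rule linearI) (simp_all add: conj_swap_def vec_eq_iff forall_8 vector_8)

lemma bounded_linear_conj_swap: "bounded_linear conj_swap"
  using linear_conj_swap linear_conv_bounded_linear by blast

lemma monomials_slot: "(a, b) \<in> exps \<Longrightarrow> monomials ax z \<zeta> $ slot a b = z ^ a * \<zeta> ^ b"
  unfolding monomials_def exps_def
  by (elim insertE emptyE Pair_inject; simp add: slot_simps axis_def del: One_nat_def)

lemma conj_swap_monomials: "conj_swap (monomials ax z \<zeta>) = - monomials ax (cnj \<zeta>) (cnj z)"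
  unfolding vec_eq_slots by (auto simp: conj_swap_slot monomials_slot exps_swap mult.commute)

lemma has_derivative_monomials_curve:
  assumes "(f has_field_derivative f') (at s)" "(g has_field_derivative g') (at s)"
  shows "\<exists>v. ((\<lambda>s. monomials E (f s) (g s)) has_derivative (\<lambda>h. h *s v)) (at s)"
proof -
  define d where "d x = (of_nat (fst x) * (f' * f s ^ (fst x - Suc 0))) * g s ^ snd x
      + (of_nat (snd x) * (g' * g s ^ (snd x - Suc 0))) * f s ^ fst x" for x :: "nat \<times> nat"
  have "((\<lambda>s. f s ^ fst x * g s ^ snd x) has_field_derivative d x) (at s)" for x
    unfolding d_def by (intro DERIV_mult DERIV_power assms)
  then have "((\<lambda>s. monomials E (f s) (g s)) has_derivative (\<lambda>h. \<Sum>x\<in>exps. h *s (d x *s E (fst x) (snd x)))) (at s)"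
    unfolding monomials_def case_prod_unfold by (intro has_derivative_sum has_derivative_smult)
  then show ?thesis unfolding vec.scale_sum_right[symmetric] by blast
qed

text \<open>A point \<open>(z, \<zeta>, y)\<close> of the complexified model lies on a complex line parametrised by \<open>s\<close> whose points
  with real \<open>s\<close> satisfy \<open>\<zeta> = cnj z\<close> and the reality condition on \<open>y\<close>. The difference of both sides of the equation is
  holomorphic in \<open>s\<close> and vanishes for real \<open>s\<close>; the point itself is reached at \<open>s = \<i>\<close>, while
  its reflection is reached at \<open>s = - \<i>\<close>.\<close>

lemma tangency_complexified:
  fixes Z :: "complex \<Rightarrow> complex^8 \<Rightarrow> complex" and V :: "complex \<Rightarrow> complex^8 \<Rightarrow> complex^8"
  assumes R1: "R1 > 0"
    and Zd: "\<And>z y. norm z < R1 \<Longrightarrow> norm y < R1 \<Longrightarrow> ((\<lambda>(z, v). Z z v) has_derivative DZ z y) (at (z, y))"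
    and DZ: "\<And>z y c h v. norm z < R1 \<Longrightarrow> norm y < R1 \<Longrightarrow> DZ z y (c * h, c *s v) = c * DZ z y (h, v)"
    and Vd: "\<And>z y. norm z < R1 \<Longrightarrow> norm y < R1 \<Longrightarrow> ((\<lambda>(z, v). V z v) has_derivative DV z y) (at (z, y))"
    and DV: "\<And>z y c h v. norm z < R1 \<Longrightarrow> norm y < R1 \<Longrightarrow> DV z y (c * h, c *s v) = c *s DV z y (h, v)"
    and tang: "\<And>z y a b. norm z < R1 \<Longrightarrow> norm y < R1 \<Longrightarrow> y = conj_swap y + monomials ax z (cnj z) \<Longrightarrow> (a, b) \<in> exps \<Longrightarrow>
      V z y $ slot a b - conj_swap (V z y) $ slot a b =
        of_nat a * z ^ (a - 1) * cnj z ^ b * Z z y + of_nat b * z ^ a * cnj z ^ (b - 1) * cnj (Z z y)"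
  obtains R where "R > 0" "R \<le> R1" "\<And>z \<zeta> y a b. norm z < R \<Longrightarrow> norm \<zeta> < R \<Longrightarrow> norm y < R \<Longrightarrow> (a, b) \<in> exps \<Longrightarrow>
      V z (y + monomials ax z \<zeta>) $ slot a b - conj_swap (V (cnj \<zeta>) (conj_swap y)) $ slot a b =
        of_nat a * z ^ (a - 1) * \<zeta> ^ b * Z z (y + monomials ax z \<zeta>)
        + of_nat b * z ^ a * \<zeta> ^ (b - 1) * cnj (Z (cnj \<zeta>) (conj_swap y))"
proof -
  obtain \<sigma> where \<sigma>: "\<sigma> > 0" and \<sigma>': "\<And>z \<zeta>. norm z < \<sigma> \<Longrightarrow> norm \<zeta> < \<sigma> \<Longrightarrow> norm (monomials ax z \<zeta>) < R1 / 4"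
    using monomials_small[of "R1 / 4" ax] R1 by auto
  \<comment> \<open>On the part \<open>norm s < 2\<close> of the line through a point of size less than \<open>R\<close>, the norms of \<open>z\<close> and \<open>\<zeta>\<close> stay
    below \<open>3 * R\<close> and that of \<open>y\<close> below \<open>3 * R + R1 / 2\<close>.\<close>
  define R where "R = min (\<sigma> / 3) (R1 / 6)"
  have R: "R > 0" "3 * R \<le> \<sigma>" "6 * R \<le> R1" using \<sigma> R1 by (auto simp: R_def)
  show ?thesis
  proof (rule that)
    show "R > 0" "R \<le> R1" using R by auto
    fix z \<zeta> :: complex and y :: "complex^8" and a b
    assume z: "norm z < R" and \<zeta>: "norm \<zeta> < R" and y: "norm y < R" and ab: "(a, b) \<in> exps"
    define \<alpha> \<beta> where "\<alpha> = (z + cnj \<zeta>) / 2" and "\<beta> = (z - cnj \<zeta>) / (2 * \<i>)"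
    \<comment> \<open>\<open>u\<close> is the midpoint of the two points \<open>y\<close> and \<open>y + monomials ax z \<zeta>\<close>; on the real model it is fixed
      by \<open>conj_swap\<close>, so \<open>u1\<close> and \<open>u2\<close> are its real and imaginary parts for this involution.\<close>
    define u where "u = y + (1/2) *s monomials ax z \<zeta>"
    define u1 u2 where "u1 = (1/2) *s (u + conj_swap u)" and "u2 = (1 / (2 * \<i>)) *s (u - conj_swap u)"
    define zs where "zs s = \<alpha> + s * \<beta>" for s
    define \<zeta>s where "\<zeta>s s = cnj \<alpha> + s * cnj \<beta>" for s
    define us where "us s = u1 + s *s u2" for s
    define ys where "ys s = us s + (1/2) *s monomials ax (zs s) (\<zeta>s s)" for s
    have smult_norm: "norm (c *s (x::complex^8)) = norm c * norm x" for c x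
      by (simp add: norm_vec_def L2_set_def norm_mult power_mult_distrib real_sqrt_mult flip: sum_distrib_left)
    have na: "norm \<alpha> \<le> R" "norm \<beta> \<le> R"
      using norm_triangle_ineq[of z "cnj \<zeta>"] norm_triangle_ineq4[of z "cnj \<zeta>"] z \<zeta>
      by (auto simp: \<alpha>_def \<beta>_def norm_divide norm_mult)
    have nzs: "norm (zs s) < 3 * R" "norm (\<zeta>s s) < 3 * R" if "norm s < 2" for s
    proof -
      have "norm s * norm \<beta> < 2 * R"
      proof (cases "\<beta> = 0")
        case False
        have "norm s * norm \<beta> < 2 * norm \<beta>" using that False by simp
        also have "\<dots> \<le> 2 * R" using na by simp
        finally show ?thesis .
      qed (use R in simp)
      then show "norm (zs s) < 3 * R" "norm (\<zeta>s s) < 3 * R"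
        using norm_triangle_ineq[of \<alpha> "s * \<beta>"] norm_triangle_ineq[of "cnj \<alpha>" "s * cnj \<beta>"] na
        by (auto simp: zs_def \<zeta>s_def norm_mult)
    qed
    have nu: "norm u < R + R1 / 8"
      using \<sigma>'[of z \<zeta>] z \<zeta> y R norm_triangle_ineq[of y "(1/2) *s monomials ax z \<zeta>"]
      by (simp add: u_def smult_norm norm_divide)
    have nu12: "norm u1 \<le> norm u" "norm u2 \<le> norm u"
      using norm_triangle_ineq[of u "conj_swap u"] norm_triangle_ineq4[of u "conj_swap u"]
      unfolding u1_def u2_def smult_norm by (simp_all add: norm_divide norm_mult)
    have nys: "norm (ys s) < R1" if "norm s < 2" for s
    proof -
      have "norm (us s) \<le> norm u1 + norm s * norm u2"
        unfolding us_def by (metis norm_triangle_ineq smult_norm)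
      also have "\<dots> \<le> norm u + 2 * norm u"
        using that by (intro add_mono mult_mono nu12) auto
      finally have 1: "norm (us s) < 3 * R + 3 * (R1 / 8)" using nu by simp
      have "norm (ys s) \<le> norm (us s) + norm (monomials ax (zs s) (\<zeta>s s)) / 2"
        unfolding ys_def using norm_triangle_ineq[of "us s" "(1/2) *s monomials ax (zs s) (\<zeta>s s)"]
        by (simp add: smult_norm norm_divide)
      also have "\<dots> < 3 * R + 3 * (R1 / 8) + (R1 / 4) / 2"
        using 1 \<sigma>'[of "zs s" "\<zeta>s s"] nzs[OF that] R by (intro add_strict_mono) auto
      finally show ?thesis using R by simp
    qed
    have nzs': "norm (zs s) < R1" if "norm s < 2" for s using nzs[OF that] R by simp
    define kZ where "kZ s = Z (zs s) (ys s)" for s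
    define kV where "kV a b s = V (zs s) (ys s) $ slot a b" for a b s
    have curve: "\<exists>v. ((\<lambda>s. (zs s, ys s)) has_derivative (\<lambda>h. (h * \<beta>, h *s v))) (at s)" for s
    proof -
      have dz: "(zs has_field_derivative \<beta>) (at s)" "(\<zeta>s has_field_derivative cnj \<beta>) (at s)"
        unfolding zs_def \<zeta>s_def by (auto intro!: derivative_eq_intros)
      obtain v where v: "((\<lambda>s. monomials ax (zs s) (\<zeta>s s)) has_derivative (\<lambda>h. h *s v)) (at s)"
        using has_derivative_monomials_curve[OF dz] by blast
      have "(ys has_derivative (\<lambda>h. (0 + h *s u2) + (1/2) *s (h *s v))) (at s)"
        unfolding ys_def us_def
        by (intro has_derivative_add has_derivative_const v bounded_linear.has_derivative[OF bounded_linear_smult]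
           has_derivative_ident bounded_linear.has_derivative[OF bounded_linear_smult_right])
      then have "(ys has_derivative (\<lambda>h. h *s (u2 + (1/2) *s v))) (at s)"
        by (rule has_derivative_eq_rhs) (simp add: fun_eq_iff vec_eq_iff algebra_simps)
      then have "((\<lambda>s. (zs s, ys s)) has_derivative (\<lambda>h. (h * \<beta>, h *s (u2 + (1/2) *s v)))) (at s)"
        using dz(1) unfolding has_field_derivative_def
        by (intro has_derivative_Pair) (simp_all add: mult_commute_abs)
      then show ?thesis by blast
    qed
    have kZ_hol: "kZ holomorphic_on ball 0 2"
    proof (rule holomorphic_onI)
      fix s :: complex assume "s \<in> ball 0 2"
      then have s: "norm s < 2" by simp
      obtain v where "((\<lambda>s. (zs s, ys s)) has_derivative (\<lambda>h. (h * \<beta>, h *s v))) (at s)" using curve by blast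
      from has_derivative_along[OF this Zd[OF nzs'[OF s] nys[OF s]]]
      have "(kZ has_derivative (\<lambda>h. DZ (zs s) (ys s) (h * \<beta>, h *s v))) (at s)"
        by (simp add: kZ_def[abs_def])
      then have "(kZ has_field_derivative DZ (zs s) (ys s) (\<beta>, v)) (at s)"
        unfolding has_field_derivative_def
        by (rule has_derivative_eq_rhs) (simp add: fun_eq_iff DZ[OF nzs'[OF s] nys[OF s]] mult.commute)
      then show "kZ field_differentiable at s within ball 0 2"
        using field_differentiable_at_within field_differentiable_def by blast
    qed
    have kV_hol: "kV a b holomorphic_on ball 0 2" for a b
    proof (rule holomorphic_onI)
      fix s :: complex assume "s \<in> ball 0 2"
      then have s: "norm s < 2" by simp
      obtain v where "((\<lambda>s. (zs s, ys s)) has_derivative (\<lambda>h. (h * \<beta>, h *s v))) (at s)" using curve by blast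
      from bounded_linear.has_derivative[OF bounded_linear_vec_nth
          has_derivative_along[OF this Vd[OF nzs'[OF s] nys[OF s]]]]
      have "(kV a b has_derivative (\<lambda>h. DV (zs s) (ys s) (h * \<beta>, h *s v) $ slot a b)) (at s)"
        by (simp add: kV_def[abs_def])
      then have "(kV a b has_field_derivative DV (zs s) (ys s) (\<beta>, v) $ slot a b) (at s)"
        unfolding has_field_derivative_def
        by (rule has_derivative_eq_rhs) (simp add: fun_eq_iff DV[OF nzs'[OF s] nys[OF s]] mult.commute)
      then show "kV a b field_differentiable at s within ball 0 2"
        using field_differentiable_at_within field_differentiable_def by blast
    qed
    have cnj_hol: "(\<lambda>s. cnj (f (cnj s))) holomorphic_on ball 0 2" if "f holomorphic_on ball 0 2" for f
    proof -
      have "cnj ` ball 0 2 = ball 0 2"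
        unfolding image_cnj_conv_vimage_cnj by (auto simp: vimage_def)
      then show ?thesis using holomorphic_on_compose_cnj_cnj[of f "ball 0 2"] that by (simp add: o_def)
    qed
    define h where "h s = kV a b s + cnj (kV b a (cnj s)) - (of_nat a * zs s ^ (a - 1) * \<zeta>s s ^ b * kZ s
        + of_nat b * zs s ^ a * \<zeta>s s ^ (b - 1) * cnj (kZ (cnj s)))" for s
    have "(\<lambda>s. zs s) holomorphic_on ball 0 2" "(\<lambda>s. \<zeta>s s) holomorphic_on ball 0 2"
      unfolding zs_def \<zeta>s_def by (intro holomorphic_intros)+
    then have "h holomorphic_on ball 0 2"
      unfolding h_def
      by (intro holomorphic_intros kZ_hol kV_hol cnj_hol[OF kZ_hol] cnj_hol[OF kV_hol])
    moreover have "h s = 0" if "s \<in> of_real ` {-1<..<1}" for s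
    proof -
      from that obtain t where s: "s = of_real t" "\<bar>t\<bar> < 1" by (auto simp: abs_less_iff)
      have s2: "norm s < 2" using s by simp
      have cs: "cnj s = s" using s by simp
      have \<zeta>s: "\<zeta>s s = cnj (zs s)" using cs by (simp add: \<zeta>s_def zs_def)
      have "conj_swap u1 = u1" "conj_swap u2 = u2"
        unfolding u1_def u2_def conj_swap_scale
        by (simp_all add: conj_swap_add conj_swap_conj_swap linear_diff[OF linear_conj_swap] add.commute vec_eq_iff field_simps)
      then have us: "conj_swap (us s) = us s"
        by (simp add: us_def conj_swap_add conj_swap_scale cs)
      have "ys s = conj_swap (ys s) + monomials ax (zs s) (cnj (zs s))"
        unfolding ys_def conj_swap_add us conj_swap_scale conj_swap_monomials \<zeta>s
        by (simp add: vec_eq_iff)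
      from tang[OF nzs'[OF s2] nys[OF s2] this ab] show ?thesis
        by (simp add: h_def kV_def kZ_def conj_swap_slot[OF ab] cs \<zeta>s)
    qed
    moreover have "(0::complex) islimpt of_real ` {-1<..<1::real}"
    proof (unfold islimpt_approachable, intro allI impI)
      fix e :: real assume "e > 0"
      then have "of_real (min (e / 2) (1 / 2)) \<in> complex_of_real ` {-1<..<1}"
        "complex_of_real (min (e / 2) (1 / 2)) \<noteq> 0" "dist (complex_of_real (min (e / 2) (1 / 2))) 0 < e"
        by (auto simp: min_def)
      then show "\<exists>x'\<in>complex_of_real ` {-1<..<1}. x' \<noteq> 0 \<and> dist x' 0 < e" by blast
    qed
    moreover have "complex_of_real ` {-1<..<1} \<subseteq> ball 0 2" by auto
    ultimately have "h \<i> = 0"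
      using analytic_continuation[of h "ball 0 2" "of_real ` {-1<..<1}" 0 \<i>] by auto
    moreover have "zs \<i> = z" "\<zeta>s \<i> = \<zeta>" "zs (- \<i>) = cnj \<zeta>" "\<zeta>s (- \<i>) = cnj z"
      by (simp_all add: zs_def \<zeta>s_def \<alpha>_def \<beta>_def field_simps)
    moreover have "us \<i> = u" "us (- \<i>) = conj_swap u"
      by (simp_all add: us_def u1_def u2_def vec_eq_iff field_simps)
    moreover have "u + (1/2) *s monomials ax z \<zeta> = y + monomials ax z \<zeta>"
      by (simp add: u_def vec_eq_iff)
    moreover have "conj_swap u + (1/2) *s monomials ax (cnj \<zeta>) (cnj z) = conj_swap y"
      by (simp add: u_def conj_swap_add conj_swap_scale conj_swap_monomials vec_eq_iff)
    ultimately show "V z (y + monomials ax z \<zeta>) $ slot a b - conj_swap (V (cnj \<zeta>) (conj_swap y)) $ slot a b =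
        of_nat a * z ^ (a - 1) * \<zeta> ^ b * Z z (y + monomials ax z \<zeta>)
        + of_nat b * z ^ a * \<zeta> ^ (b - 1) * cnj (Z (cnj \<zeta>) (conj_swap y))"
      unfolding conj_swap_slot[OF ab] by (simp add: h_def kV_def kZ_def ys_def)
  qed
qed

section \<open>Vector fields tangent to the model\<close>

definition to_w :: "complex^8 \<Rightarrow> complex^8"
  where "to_w y = vector [2 * \<i> * y$1, 2 * \<i> * (y$2 + y$3), 2 * (y$2 - y$3), 2 * \<i> * (y$4 + y$5), 2 * (y$4 - y$5),
    2 * \<i> * y$6, 2 * \<i> * (y$7 + y$8), 2 * (y$7 - y$8)]"

definition to_y :: "complex^8 \<Rightarrow> complex^8"
  where "to_y w = vector [w$1 / (2 * \<i>), (w$2 + \<i> * w$3) / (4 * \<i>), (w$2 - \<i> * w$3) / (4 * \<i>),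
    (w$4 + \<i> * w$5) / (4 * \<i>), (w$4 - \<i> * w$5) / (4 * \<i>), w$6 / (2 * \<i>),
    (w$7 + \<i> * w$8) / (4 * \<i>), (w$7 - \<i> * w$8) / (4 * \<i>)]"

lemma to_y_to_w [simp]: "to_y (to_w y) = y"
  by (simp add: to_y_def to_w_def vec_eq_iff forall_8 vector_8 field_simps)

lemma to_w_to_y [simp]: "to_w (to_y w) = w"
  by (simp add: to_y_def to_w_def vec_eq_iff forall_8 vector_8 field_simps)

lemma to_w_eq_iff: "w = to_w y \<longleftrightarrow> to_y w = y"
proof
  assume "to_y w = y"
  then show "w = to_w y" using to_w_to_y[of w] by simp
qed simp

lemma to_w_scale: "to_w (c *s y) = c *s to_w y"
  by (simp add: to_w_def vec_eq_iff forall_8 vector_8 algebra_simps)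

lemma to_y_scale: "to_y (c *s y) = c *s to_y y"
  by (simp add: to_y_def vec_eq_iff forall_8 vector_8 field_simps)

lemma scaleR_eq_smult: "r *\<^sub>R y = of_real r *s y" for y :: "complex^8"
  unfolding vec_eq_iff vector_scaleR_component vector_smult_component by (simp add: scaleR_conv_of_real)

lemma bounded_linear_to_w: "bounded_linear to_w"
  unfolding linear_conv_bounded_linear[symmetric]
proof (rule linearI)
  show "to_w (x + y) = to_w x + to_w y" for x y
    by (simp add: to_w_def vec_eq_iff forall_8 vector_8 algebra_simps)
  show "to_w (r *\<^sub>R x) = r *\<^sub>R to_w x" for r x
    unfolding scaleR_eq_smult by (rule to_w_scale)
qed

lemma bounded_linear_to_y: "bounded_linear to_y"
  unfolding linear_conv_bounded_linear[symmetric]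
proof (rule linearI)
  show "to_y (x + y) = to_y x + to_y y" for x y
    by (simp add: to_y_def vec_eq_iff forall_8 vector_8 field_simps)
  show "to_y (r *\<^sub>R x) = r *\<^sub>R to_y x" for r x
    unfolding scaleR_eq_smult by (rule to_y_scale)
qed

lemma to_y_diff_conj_swap: "to_y w - conj_swap (to_y w) = to_y (\<chi> k. w $ k - cnj (w $ k))"
  by (simp add: to_y_def conj_swap_def vec_eq_iff forall_8 vector_8 field_simps)

lemma M1_iff: "(z, w) \<in> M1 \<longleftrightarrow> to_y w - conj_swap (to_y w) = monomials ax z (cnj z)"
proof -
  have m: "monomials ax z (cnj z) $ 1 = z * cnj z" "monomials ax z (cnj z) $ 2 = z^2 * cnj z"
    "monomials ax z (cnj z) $ 3 = z * (cnj z)^2" "monomials ax z (cnj z) $ 4 = z^3 * cnj z"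
    "monomials ax z (cnj z) $ 5 = z * (cnj z)^3" "monomials ax z (cnj z) $ 6 = z^2 * (cnj z)^2"
    "monomials ax z (cnj z) $ 7 = z^4 * cnj z" "monomials ax z (cnj z) $ 8 = z * (cnj z)^4"
    using monomials_slot[of _ _ z "cnj z"] by (simp_all add: exps_def slot_simps flip: slot_simps)
  have "(\<chi> k. w $ k - cnj (w $ k)) = to_w (monomials ax z (cnj z)) \<longleftrightarrow>
      (\<forall>k. w $ k - cnj (w $ k) = to_w (monomials ax z (cnj z)) $ k)"
    by (simp add: vec_eq_iff)
  also have "\<dots> \<longleftrightarrow> (z, w) \<in> M1"
    unfolding forall_8 to_w_def vector_8 m M1_def mem_Collect_eq case_prod_conv
    by (simp only: mult.assoc)
  finally have "(z, w) \<in> M1 \<longleftrightarrow> (\<chi> k. w $ k - cnj (w $ k)) = to_w (monomials ax z (cnj z))" by (rule sym)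
  also have "\<dots> \<longleftrightarrow> to_y (\<chi> k. w $ k - cnj (w $ k)) = monomials ax z (cnj z)"
    by (rule to_w_eq_iff)
  finally show ?thesis unfolding to_y_diff_conj_swap .
qed

text \<open>The derivative of \<open>(z\<^sup>a (cnj z)\<^sup>b)\<close> in the real direction \<open>\<alpha>\<close>.\<close>

definition monomials_dir :: "complex \<Rightarrow> complex \<Rightarrow> complex^8"
  where "monomials_dir z \<alpha> = (\<Sum>(a,b)\<in>exps. (of_nat a * z ^ (a - 1) * cnj z ^ b * \<alpha>
    + of_nat b * z ^ a * cnj z ^ (b - 1) * cnj \<alpha>) *s ax a b)"

lemma monomials_dir_slot: "(a, b) \<in> exps \<Longrightarrow> monomials_dir z \<alpha> $ slot a b =
    of_nat a * z ^ (a - 1) * cnj z ^ b * \<alpha> + of_nat b * z ^ a * cnj z ^ (b - 1) * cnj \<alpha>"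
  unfolding monomials_dir_def exps_def
  by (elim insertE emptyE Pair_inject; simp add: slot_simps axis_def del: One_nat_def)

lemma has_vector_derivative_monomials:
  fixes f :: "real \<Rightarrow> complex"
  assumes "(f has_vector_derivative \<alpha>) (at t)"
  shows "((\<lambda>t. monomials ax (f t) (cnj (f t))) has_vector_derivative monomials_dir (f t) \<alpha>) (at t)"
proof -
  have p: "((\<lambda>t. g t ^ n) has_vector_derivative of_nat n * g t ^ (n - 1) * \<gamma>) (at t)"
    if "(g has_vector_derivative \<gamma>) (at t)" for g :: "real \<Rightarrow> complex" and \<gamma> n
  proof -
    have "((\<lambda>z. z ^ n) has_field_derivative of_nat n * g t ^ (n - 1)) (at (g t))"
      by (auto intro!: derivative_eq_intros)
    from field_vector_diff_chain_at[OF that this] show ?thesis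
      by (simp add: o_def mult_ac)
  qed
  have c: "((\<lambda>t. cnj (f t)) has_vector_derivative cnj \<alpha>) (at t)"
    using assms by (rule has_vector_derivative_cnj)
  have "((\<lambda>t. (f t ^ a * cnj (f t) ^ b) *s ax a b) has_vector_derivative
      (of_nat a * f t ^ (a - 1) * cnj (f t) ^ b * \<alpha> + of_nat b * f t ^ a * cnj (f t) ^ (b - 1) * cnj \<alpha>) *s ax a b) (at t)"
    for a b
  proof -
    have "((\<lambda>t. f t ^ a * cnj (f t) ^ b) has_vector_derivative
      f t ^ a * (of_nat b * cnj (f t) ^ (b - 1) * cnj \<alpha>) + of_nat a * f t ^ (a - 1) * \<alpha> * cnj (f t) ^ b) (at t)"
      by (intro has_vector_derivative_mult p assms c)
    from bounded_linear.has_vector_derivative[OF bounded_linear_smult this] show ?thesis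
      by (simp add: algebra_simps)
  qed
  then show ?thesis
    unfolding monomials_def monomials_dir_def case_prod_unfold by (intro has_vector_derivative_sum)
qed

text \<open>Velocities satisfy the differentiated equations. Conversely \<open>M1\<close> is a graph over \<open>z\<close> and
  the part of \<open>y\<close> fixed by \<open>conj_swap\<close>, so an affine motion of these two can be lifted to a curve in \<open>M1\<close>.\<close>

lemma tangent_space_M1_iff:
  assumes zw: "(z, w) \<in> M1"
  shows "(\<alpha>, \<beta>) \<in> tangent_space M1 (z, w) \<longleftrightarrow> to_y \<beta> - conj_swap (to_y \<beta>) = monomials_dir z \<alpha>"
proof
  assume "(\<alpha>, \<beta>) \<in> tangent_space M1 (z, w)"
  then obtain \<gamma> :: "real \<Rightarrow> cspace" where \<gamma>: "\<gamma> 0 = (z, w)" "\<forall>\<^sub>F t in nhds 0. \<gamma> t \<in> M1"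
    "(\<gamma> has_vector_derivative (\<alpha>, \<beta>)) (at 0)"
    unfolding tangent_space_def by blast
  define Y where "Y t = to_y (snd (\<gamma> t))" for t
  have z': "((\<lambda>t. fst (\<gamma> t)) has_vector_derivative \<alpha>) (at 0)"
    using bounded_linear.has_vector_derivative[OF bounded_linear_fst \<gamma>(3)] by simp
  have w': "((\<lambda>t. snd (\<gamma> t)) has_vector_derivative \<beta>) (at 0)"
    using bounded_linear.has_vector_derivative[OF bounded_linear_snd \<gamma>(3)] by simp
  have Y': "(Y has_vector_derivative to_y \<beta>) (at 0)"
    unfolding Y_def by (rule bounded_linear.has_vector_derivative[OF bounded_linear_to_y w'])
  have "((\<lambda>t. Y t - conj_swap (Y t) - monomials ax (fst (\<gamma> t)) (cnj (fst (\<gamma> t)))) has_vector_derivative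
      to_y \<beta> - conj_swap (to_y \<beta>) - monomials_dir (fst (\<gamma> 0)) \<alpha>) (at 0)"
    by (intro has_vector_derivative_diff Y' has_vector_derivative_monomials z'
        bounded_linear.has_vector_derivative[OF bounded_linear_conj_swap])
  moreover have "\<forall>\<^sub>F t in nhds 0. Y t - conj_swap (Y t) - monomials ax (fst (\<gamma> t)) (cnj (fst (\<gamma> t))) = 0"
    using \<gamma>(2) by (rule eventually_mono) (simp add: Y_def flip: M1_iff)
  then have "((\<lambda>t. Y t - conj_swap (Y t) - monomials ax (fst (\<gamma> t)) (cnj (fst (\<gamma> t)))) has_vector_derivative 0) (at 0)
    \<longleftrightarrow> ((\<lambda>t::real. 0 :: complex^8) has_vector_derivative 0) (at 0)"
    by (intro has_vector_derivative_cong_ev) (auto elim: eventually_mono dest: eventually_nhds_x_imp_x)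
  ultimately have "to_y \<beta> - conj_swap (to_y \<beta>) - monomials_dir (fst (\<gamma> 0)) \<alpha> = 0"
    using vector_derivative_unique_at has_vector_derivative_const by blast
  then show "to_y \<beta> - conj_swap (to_y \<beta>) = monomials_dir z \<alpha>" using \<gamma>(1) by simp
next
  assume eq: "to_y \<beta> - conj_swap (to_y \<beta>) = monomials_dir z \<alpha>"
  \<comment> \<open>The projection to the part fixed by \<open>conj_swap\<close>; the remaining part of a point of \<open>M1\<close> is half of the monomials.\<close>
  define re where "re y = (1/2) *s (y + conj_swap y)" for y
  have re: "conj_swap (re y) = re y" for y
    by (simp add: re_def conj_swap_add conj_swap_scale conj_swap_conj_swap add.commute)
  define Z where "Z t = z + of_real t * \<alpha>" for t
  define Y where "Y t = re (to_y w) + t *\<^sub>R re (to_y \<beta>) + (1/2) *s monomials ax (Z t) (cnj (Z t))" for t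
  have Z': "(Z has_vector_derivative \<alpha>) (at 0)"
    unfolding Z_def has_vector_derivative_def
    by (auto intro!: derivative_eq_intros simp: scaleR_conv_of_real)
  have "(Y has_vector_derivative (0 + 1 *\<^sub>R re (to_y \<beta>)) + (1/2) *s monomials_dir (Z 0) \<alpha>) (at 0)"
    unfolding Y_def
    by (intro has_vector_derivative_add has_vector_derivative_const has_vector_derivative_monomials Z'
        bounded_linear.has_vector_derivative[OF bounded_linear_smult_right]
        bounded_linear.has_vector_derivative[OF bounded_linear_scaleR_left] has_vector_derivative_id)
  moreover have "(0 + 1 *\<^sub>R re (to_y \<beta>)) + (1/2) *s monomials_dir (Z 0) \<alpha> = to_y \<beta>"
    unfolding re_def Z_def using eq[symmetric] by (simp add: vec_eq_iff field_simps)
  ultimately have "(Y has_vector_derivative to_y \<beta>) (at 0)" by simp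
  from bounded_linear.has_vector_derivative[OF bounded_linear_to_w this]
  have "((\<lambda>t. to_w (Y t)) has_vector_derivative \<beta>) (at 0)" by simp
  then have "((\<lambda>t. (Z t, to_w (Y t))) has_vector_derivative (\<alpha>, \<beta>)) (at 0)"
    using Z' by (intro has_vector_derivative_Pair)
  moreover have "(Z t, to_w (Y t)) \<in> M1" for t
  proof -
    have "conj_swap (Y t) = re (to_y w) + t *\<^sub>R re (to_y \<beta>) - (1/2) *s monomials ax (Z t) (cnj (Z t))"
      unfolding Y_def conj_swap_add linear_scale[OF linear_conj_swap] re conj_swap_scale conj_swap_monomials
      by (simp add: vec_eq_iff)
    then have "Y t - conj_swap (Y t) = monomials ax (Z t) (cnj (Z t))"
      by (simp add: Y_def vec_eq_iff)
    then show ?thesis by (simp add: M1_iff)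
  qed
  moreover have "to_w (Y 0) = w"
  proof -
    have "to_y w - conj_swap (to_y w) = monomials ax z (cnj z)" using zw M1_iff by simp
    moreover have "Z 0 = z" by (simp add: Z_def)
    ultimately have "Y 0 = re (to_y w) + (1/2) *s (to_y w - conj_swap (to_y w))"
      by (simp add: Y_def)
    also have "\<dots> = to_y w" by (simp add: re_def vec_eq_iff field_simps)
    finally show ?thesis by simp
  qed
  then have "(Z 0, to_w (Y 0)) = (z, w)" by (simp add: Z_def)
  ultimately show "(\<alpha>, \<beta>) \<in> tangent_space M1 (z, w)"
    unfolding tangent_space_def by (intro CollectI exI[of _ "\<lambda>t. (Z t, to_w (Y t))"]) simp
qed

lemma germ_eq_iff: "germ F = germ G \<longleftrightarrow> (\<forall>\<^sub>F p in nhds 0. F p = G p)"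
  by transfer simp

lemma germ_eq_0_iff: "germ F = 0 \<longleftrightarrow> (\<forall>\<^sub>F p in nhds 0. F p = 0)"
  by transfer simp

text \<open>In the coordinates \<open>y\<close> the reflected unknowns are \<open>Z'(\<zeta>, y) = cnj (Z(cnj \<zeta>, conj_swap y))\<close> and
  \<open>V'(\<zeta>, y) = conj_swap (V(cnj \<zeta>, conj_swap y))\<close>; they are again holomorphic, so the rigidity result applies.\<close>

lemma tangent_field_zero_of_initial_data:
  assumes F: "holomorphic_near F U" and T: "\<And>p. p \<in> M1 \<Longrightarrow> p \<in> U \<Longrightarrow> F p \<in> tangent_space M1 p"
    and init: "F 0 = 0" "fst (frechet_derivative F (at 0) (1, 0)) = 0"
  shows "germ F = 0"
proof -
  define D where "D p = frechet_derivative F (at p)" for p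
  have U: "open U" "0 \<in> U" using F by (auto simp: holomorphic_near_def)
  have D: "(F has_derivative D p) (at p)" and Ds: "D p (cscale c v) = cscale c (D p v)" if "p \<in> U" for p c v
  proof -
    obtain D' where D': "(F has_derivative D') (at p)" "\<And>c v. D' (cscale c v) = cscale c (D' v)"
      using F \<open>p \<in> U\<close> unfolding holomorphic_near_def by blast
    then have "D p = D'" unfolding D_def using frechet_derivative_at by blast
    then show "(F has_derivative D p) (at p)" "D p (cscale c v) = cscale c (D p v)" using D' by auto
  qed
  define \<Psi> where "\<Psi> p = (fst p, to_w (snd p))" for p :: cspace
  have bl: "bounded_linear \<Psi>"
    unfolding \<Psi>_def by (intro bounded_linear_Pair bounded_linear_fst
        bounded_linear_compose[OF bounded_linear_to_w bounded_linear_snd])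
  have "continuous_on UNIV \<Psi>" by (rule bounded_linear.continuous_on[OF bl continuous_on_id])
  then have "open (\<Psi> -` U)" using U(1) open_vimage by blast
  moreover have "0 \<in> \<Psi> -` U" using U(2) linear_0[OF bounded_linear.linear[OF bl]] by simp
  ultimately obtain e where e: "e > 0" "ball 0 e \<subseteq> \<Psi> -` U" using open_contains_ball by blast
  define R1 where "R1 = e / 2"
  have R1: "R1 > 0" using e by (simp add: R1_def)
  have inU: "(z, to_w y) \<in> U" if "norm z < R1" "norm y < R1" for z y
  proof -
    have "norm (z, y) < e" using norm_Pair_le[of z y] that by (simp add: R1_def)
    then show ?thesis using e(2) by (auto simp: \<Psi>_def)
  qed
  define Z where "Z z y = fst (F (z, to_w y))" for z y
  define V where "V z y = to_y (snd (F (z, to_w y)))" for z y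
  define DZ where "DZ z y hv = fst (D (z, to_w y) (\<Psi> hv))" for z y hv
  define DV where "DV z y hv = to_y (snd (D (z, to_w y) (\<Psi> hv)))" for z y hv
  have d\<Psi>: "((\<lambda>p. F (\<Psi> p)) has_derivative (\<lambda>hv. D (z, to_w y) (\<Psi> hv))) (at (z, y))"
    if "norm z < R1" "norm y < R1" for z y
    by (rule has_derivative_along[OF bounded_linear.has_derivative[OF bl has_derivative_ident] D[OF inU[OF that]]])
      (simp add: \<Psi>_def)
  have Zd: "((\<lambda>(z, v). Z z v) has_derivative DZ z y) (at (z, y))" if "norm z < R1" "norm y < R1" for z y
    using bounded_linear.has_derivative[OF bounded_linear_fst d\<Psi>[OF that]]
    by (simp add: Z_def DZ_def[abs_def] \<Psi>_def case_prod_unfold)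
  have Vd: "((\<lambda>(z, v). V z v) has_derivative DV z y) (at (z, y))" if "norm z < R1" "norm y < R1" for z y
    using bounded_linear.has_derivative[OF bounded_linear_to_y bounded_linear.has_derivative[OF bounded_linear_snd d\<Psi>[OF that]]]
    by (simp add: V_def DV_def[abs_def] \<Psi>_def case_prod_unfold)
  have \<Psi>c: "\<Psi> (c * h, c *s v) = cscale c (\<Psi> (h, v))" for c h v
    by (simp add: \<Psi>_def cscale_def to_w_scale)
  have DZs: "DZ z y (c * h, c *s v) = c * DZ z y (h, v)" if "norm z < R1" "norm y < R1" for z y c h v
    unfolding DZ_def \<Psi>c Ds[OF inU[OF that]] by (simp add: cscale_def)
  have DVs: "DV z y (c * h, c *s v) = c *s DV z y (h, v)" if "norm z < R1" "norm y < R1" for z y c h v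
    unfolding DV_def \<Psi>c Ds[OF inU[OF that]] by (simp add: cscale_def to_y_scale)
  have tang: "V z y $ slot a b - conj_swap (V z y) $ slot a b =
        of_nat a * z ^ (a - 1) * cnj z ^ b * Z z y + of_nat b * z ^ a * cnj z ^ (b - 1) * cnj (Z z y)"
    if "norm z < R1" "norm y < R1" "y = conj_swap y + monomials ax z (cnj z)" "(a, b) \<in> exps" for z y a b
  proof -
    have m: "(z, to_w y) \<in> M1" using that(3) by (simp add: M1_iff algebra_simps)
    have "(Z z y, snd (F (z, to_w y))) \<in> tangent_space M1 (z, to_w y)"
      using T[OF m inU[OF that(1,2)]] by (simp add: Z_def)
    then have "V z y - conj_swap (V z y) = monomials_dir z (Z z y)"
      unfolding tangent_space_M1_iff[OF m] V_def .
    then show ?thesis using monomials_dir_slot[OF that(4), of z "Z z y"] by (metis vector_minus_component)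
  qed
  obtain R where R: "R > 0" "R \<le> R1" and eq: "\<And>z \<zeta> y a b. norm z < R \<Longrightarrow> norm \<zeta> < R \<Longrightarrow> norm y < R \<Longrightarrow> (a, b) \<in> exps \<Longrightarrow>
      V z (y + monomials ax z \<zeta>) $ slot a b - conj_swap (V (cnj \<zeta>) (conj_swap y)) $ slot a b =
        of_nat a * z ^ (a - 1) * \<zeta> ^ b * Z z (y + monomials ax z \<zeta>)
        + of_nat b * z ^ a * \<zeta> ^ (b - 1) * cnj (Z (cnj \<zeta>) (conj_swap y))"
    by (rule tangency_complexified[OF R1 Zd DZs Vd DVs tang]) blast+
  define A where "A y = DZ 0 y (1, 0)" for y
  define B where "B y v = DZ 0 y (0, v)" for y v
  have lin: "linear (DZ z y)" if "norm z < R1" "norm y < R1" for z y using Zd[OF that] has_derivative_linear by blast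
  have split: "DZ 0 y (h, v) = A y * h + B y v" if "norm y < R" for y h v
  proof -
    have y: "norm (0::complex) < R1" "norm y < R1" using R R1 that by auto
    have "DZ 0 y ((h * 1, h *s 0) + (0, v)) = h * DZ 0 y (1, 0) + DZ 0 y (0, v)"
      unfolding linear_add[OF lin[OF y]] DZs[OF y] ..
    then show ?thesis by (simp add: A_def B_def mult.commute)
  qed
  have Blin: "linear (B y)" if "norm y < R" for y
  proof -
    have y: "norm (0::complex) < R1" "norm y < R1" using R R1 that by auto
    show ?thesis unfolding B_def
      using linear_compose[OF _ lin[OF y], of "\<lambda>v. (0, v)"] by (simp add: o_def linear_iff)
  qed
  have Bs: "B y (c *s v) = c * B y v" if "norm y < R" for y c v
    using DZs[of 0 y c 0 v] that R R1 by (simp add: B_def)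
  have Zd0: "((\<lambda>(z, v). Z z v) has_derivative (\<lambda>(h, v). A y * h + B y v)) (at (0, y))" if "norm y < R" for y
    by (rule has_derivative_eq_rhs[OF Zd]) (use that R R1 split in auto)
  have Zc: "isCont (Z z) y" if "norm z < R" "norm y < R" for z y
  proof -
    have "((\<lambda>v. (z, v)) has_derivative (\<lambda>h. (0, h))) (at y)" by (auto intro!: derivative_eq_intros)
    from has_derivative_along[OF this Zd[of z y]] have "(Z z has_derivative (\<lambda>h. DZ z y (0, h))) (at y)"
      using that R by simp
    then show ?thesis by (rule has_derivative_continuous)
  qed
  have Vd0: "(V 0 has_derivative (\<lambda>h. DV 0 y (0, h))) (at y)" if "norm y < R" for y
  proof -
    have "((\<lambda>v. (0, v)) has_derivative (\<lambda>h. (0, h))) (at y)" by (auto intro!: derivative_eq_intros)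
    from has_derivative_along[OF this Vd[of 0 y]] show ?thesis using that R R1 by simp
  qed
  have Zd0': "((\<lambda>(\<zeta>, v). cnj (Z (cnj \<zeta>) (conj_swap v))) has_derivative
      (\<lambda>(h, v). cnj (A (conj_swap y)) * h + cnj (B (conj_swap y) (conj_swap v)))) (at (0, y))" if "norm y < R" for y
  proof -
    have "((\<lambda>p. (cnj (fst p), conj_swap (snd p))) has_derivative (\<lambda>p. (cnj (fst p), conj_swap (snd p)))) (at (0, y))"
      by (intro has_derivative_Pair bounded_linear.has_derivative[OF bounded_linear_cnj]
          bounded_linear.has_derivative[OF bounded_linear_conj_swap] has_derivative_fst has_derivative_snd has_derivative_ident)
    from bounded_linear.has_derivative[OF bounded_linear_cnj has_derivative_along[OF this Zd0[of "conj_swap y"]]]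
    show ?thesis using that by (simp add: case_prod_unfold)
  qed
  have "linear (\<lambda>v. cnj (B (conj_swap y) (conj_swap v)))" if "norm y < R" for y
    using linear_compose[OF linear_compose[OF linear_conj_swap Blin] bounded_linear.linear[OF bounded_linear_cnj], of "conj_swap y"] that
    by (simp add: o_def)
  moreover have "cnj (B (conj_swap y) (conj_swap (c *s v))) = c * cnj (B (conj_swap y) (conj_swap v))" if "norm y < R" for y c v
    using Bs[of "conj_swap y"] that by (simp add: conj_swap_scale)
  moreover have "isCont (\<lambda>v. cnj (Z (cnj z) (conj_swap v))) y" if "norm z < R" "norm y < R" for z y
    using Zc[of "cnj z" "conj_swap y"] that
    by (intro isCont_cnj isCont_o2[of y conj_swap "Z (cnj z)"] linear_continuous_at[OF bounded_linear_conj_swap]) simp_all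
  moreover have "DV 0 y (0, c *s v) = c *s DV 0 y (0, v)" if "norm y < R" for y c v
    using DVs[of 0 y c 0 v] that R R1 by simp
  moreover have "F (0, to_w 0) = 0" "to_w 0 = 0" "to_y 0 = 0"
    using init(1) linear_0[OF bounded_linear.linear[OF bounded_linear_to_w]]
      linear_0[OF bounded_linear.linear[OF bounded_linear_to_y]] by (simp_all flip: zero_prod_def)
  then have "Z 0 0 = 0" "V 0 0 = 0" "cnj (Z (cnj 0) (conj_swap 0)) = 0" by (simp_all add: Z_def V_def)
  moreover have "A 0 = 0"
    using init(2) \<open>to_w 0 = 0\<close> by (simp add: A_def DZ_def \<Psi>_def D_def flip: zero_prod_def)
  then have "cnj (A (conj_swap 0)) = 0" by simp
  ultimately obtain \<delta> where \<delta>: "\<delta> > 0" "\<And>z y. norm z < \<delta> \<Longrightarrow> norm y < \<delta> \<Longrightarrow> Z z y = 0 \<and> V z y = 0"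
    using rigidity_of_complexified_system[OF R(1) Zd0 Blin Bs Zc Zd0' _ _ _ Vd0 _ eq] \<open>A 0 = 0\<close> by (smt (verit) complex_cnj_zero)
  have "open {p :: cspace. norm (fst p) < \<delta> \<and> norm (to_y (snd p)) < \<delta>}"
    by (intro open_Collect_conj open_Collect_less continuous_intros bounded_linear.continuous_on[OF bounded_linear_to_y])
  from eventually_nhds_in_open[OF this, of 0]
  have "\<forall>\<^sub>F p :: cspace in nhds 0. norm (fst p) < \<delta> \<and> norm (to_y (snd p)) < \<delta>"
    using \<delta>(1) \<open>to_y 0 = 0\<close> by simp
  then have "\<forall>\<^sub>F p in nhds 0. F p = 0"
  proof (rule eventually_mono)
    fix p :: cspace assume "norm (fst p) < \<delta> \<and> norm (to_y (snd p)) < \<delta>"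
    with \<delta>(2)[of "fst p" "to_y (snd p)"] have "fst (F p) = 0" "to_y (snd (F p)) = 0" by (simp_all add: Z_def V_def)
    then have "fst (F p) = 0" "snd (F p) = 0" using to_w_to_y[of "snd (F p)"] \<open>to_w 0 = 0\<close> by simp_all
    then show "F p = 0" by (simp add: prod_eq_iff)
  qed
  then show ?thesis by (simp add: germ_eq_0_iff)
qed

section \<open>The twelve-parameter family of fields\<close>

definition field_of :: "(nat \<Rightarrow> real) \<Rightarrow> cspace \<Rightarrow> cspace"
  where "field_of c = (\<lambda>(z, w). (c 9 * z + c 10 * (\<i> * z) + c 11 + c 12 * \<i>, vector [
    c 1 + 2 * c 9 * w$1 + c 11 * (2 * \<i> * z) + c 12 * (2 * z),
    c 2 + 3 * c 9 * w$2 - c 10 * w$3 + c 11 * (4 * w$1 + 2 * \<i> * z^2) + c 12 * (2 * z^2),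
    c 3 + 3 * c 9 * w$3 + c 10 * w$2 + c 11 * (2 * z^2) + c 12 * (4 * w$1 - 2 * \<i> * z^2),
    c 4 + 4 * c 9 * w$4 - 2 * c 10 * w$5 + c 11 * (3 * w$2 + 2 * \<i> * z^3) + c 12 * (- 3 * w$3 + 2 * z^3),
    c 5 + 4 * c 9 * w$5 + 2 * c 10 * w$4 + c 11 * (3 * w$3 + 2 * z^3) + c 12 * (3 * w$2 - 2 * \<i> * z^3),
    c 6 + 4 * c 9 * w$6 + c 11 * (2 * w$2) + c 12 * (2 * w$3),
    c 7 + 5 * c 9 * w$7 - 3 * c 10 * w$8 + c 11 * (4 * w$4 + 2 * \<i> * z^4) + c 12 * (- 4 * w$5 + 2 * z^4),
    c 8 + 5 * c 9 * w$8 + 3 * c 10 * w$7 + c 11 * (4 * w$5 + 2 * z^4) + c 12 * (4 * w$4 - 2 * \<i> * z^4)]))"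

definition field_deriv :: "(nat \<Rightarrow> real) \<Rightarrow> cspace \<Rightarrow> cspace \<Rightarrow> cspace"
  where "field_deriv c = (\<lambda>(z, w) (h, v). (c 9 * h + c 10 * (\<i> * h), vector [
    2 * c 9 * v$1 + c 11 * (2 * \<i> * h) + c 12 * (2 * h),
    3 * c 9 * v$2 - c 10 * v$3 + c 11 * (4 * v$1 + 4 * \<i> * z * h) + c 12 * (4 * z * h),
    3 * c 9 * v$3 + c 10 * v$2 + c 11 * (4 * z * h) + c 12 * (4 * v$1 - 4 * \<i> * z * h),
    4 * c 9 * v$4 - 2 * c 10 * v$5 + c 11 * (3 * v$2 + 6 * \<i> * z^2 * h) + c 12 * (- 3 * v$3 + 6 * z^2 * h),
    4 * c 9 * v$5 + 2 * c 10 * v$4 + c 11 * (3 * v$3 + 6 * z^2 * h) + c 12 * (3 * v$2 - 6 * \<i> * z^2 * h),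
    4 * c 9 * v$6 + c 11 * (2 * v$2) + c 12 * (2 * v$3),
    5 * c 9 * v$7 - 3 * c 10 * v$8 + c 11 * (4 * v$4 + 8 * \<i> * z^3 * h) + c 12 * (- 4 * v$5 + 8 * z^3 * h),
    5 * c 9 * v$8 + 3 * c 10 * v$7 + c 11 * (4 * v$5 + 8 * z^3 * h) + c 12 * (4 * v$4 - 8 * \<i> * z^3 * h)]))"

lemma has_derivative_vec_componentwise:
  fixes f :: "'a::real_normed_vector \<Rightarrow> complex^8"
  assumes "\<And>k. ((\<lambda>x. f x $ k) has_derivative (\<lambda>h. f' h $ k)) F"
  shows "(f has_derivative f') F"
proof -
  have decomp: "y = (\<Sum>k\<in>UNIV. y $ k *s axis k 1)" for y :: "complex^8"
    by (simp add: vec_eq_iff sum_component axis_def if_distrib[of "(*) _"] cong: if_cong)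
  have "((\<lambda>x. \<Sum>k\<in>UNIV. f x $ k *s axis k 1) has_derivative (\<lambda>h. \<Sum>k\<in>UNIV. f' h $ k *s axis k 1)) F"
    by (intro has_derivative_sum bounded_linear.has_derivative[OF bounded_linear_smult] assms)
  then show ?thesis by (simp flip: decomp)
qed

lemma has_derivative_field_of: "(field_of c has_derivative field_deriv c p) (at p)"
proof -
  obtain z w where p: "p = (z, w)" by (cases p)
  have vd: "((\<lambda>q. snd q $ k) has_derivative (\<lambda>q. snd q $ k)) (at x)" for k :: 8 and x :: cspace
    by (intro bounded_linear.has_derivative[OF bounded_linear_vec_nth] has_derivative_snd has_derivative_ident)
  have zd: "((\<lambda>q. fst q) has_derivative (\<lambda>q. fst q)) (at x)" for x :: cspace
    by (intro has_derivative_fst has_derivative_ident)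
  have pd: "((\<lambda>q. fst q ^ n) has_derivative (\<lambda>q. of_nat n * fst q * fst x ^ (n - 1))) (at x)" for x :: cspace and n
    by (rule has_derivative_power[OF zd])
  have 1: "((\<lambda>q. fst (field_of c q)) has_derivative (\<lambda>q. fst (field_deriv c p q))) (at p)"
    unfolding field_of_def field_deriv_def p case_prod_unfold fst_conv
    by (auto intro!: derivative_eq_intros zd)
  have "((\<lambda>q. snd (field_of c q) $ k) has_derivative (\<lambda>q. snd (field_deriv c p q) $ k)) (at p)" for k
  proof -
    have "\<forall>k. ((\<lambda>q. snd (field_of c q) $ k) has_derivative (\<lambda>q. snd (field_deriv c p q) $ k)) (at p)"
      unfolding forall_8 field_of_def field_deriv_def p case_prod_unfold snd_conv fst_conv vector_8
      by (intro conjI; rule has_derivative_eq_rhs,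
          (rule has_derivative_add has_derivative_diff vd pd zd has_derivative_const has_derivative_mult_right)+,
          simp add: fun_eq_iff algebra_simps)
    then show ?thesis ..
  qed
  then have "((\<lambda>q. snd (field_of c q)) has_derivative (\<lambda>q. snd (field_deriv c p q))) (at p)"
    by (rule has_derivative_vec_componentwise)
  from has_derivative_Pair[OF 1 this] show ?thesis by simp
qed

lemma field_deriv_cscale: "field_deriv c p (cscale a v) = cscale a (field_deriv c p v)"
  by (simp add: field_deriv_def cscale_def case_prod_unfold vec_eq_iff forall_8 vector_8 algebra_simps)

lemma holomorphic_near_field_of: "holomorphic_near (field_of c) UNIV"
  unfolding holomorphic_near_def using has_derivative_field_of field_deriv_cscale by blast

lemma imaginary_unit_twice: "\<i> * (\<i> * x) = - x" by (simp flip: mult.assoc)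

text \<open>The defining equations are solved for \<open>cnj (w$k)\<close>. After substitution each component of the tangency
  condition is a polynomial identity in \<open>z\<close>, \<open>cnj z\<close>, \<open>w\<close> and the coefficients.\<close>

lemma field_of_tangent:
  assumes "p \<in> M1"
  shows "field_of c p \<in> tangent_space M1 p"
proof -
  obtain z w where p: "p = (z, w)" by (cases p)
  have cw: "cnj (w$1) = w$1 - 2 * \<i> * z * cnj z"
    "cnj (w$2) = w$2 - 2 * \<i> * (z^2 * cnj z + z * (cnj z)^2)"
    "cnj (w$3) = w$3 - 2 * (z^2 * cnj z - z * (cnj z)^2)"
    "cnj (w$4) = w$4 - 2 * \<i> * (z^3 * cnj z + z * (cnj z)^3)"
    "cnj (w$5) = w$5 - 2 * (z^3 * cnj z - z * (cnj z)^3)"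
    "cnj (w$6) = w$6 - 2 * \<i> * z^2 * (cnj z)^2"
    "cnj (w$7) = w$7 - 2 * \<i> * (z^4 * cnj z + z * (cnj z)^4)"
    "cnj (w$8) = w$8 - 2 * (z^4 * cnj z - z * (cnj z)^4)"
    using assms unfolding M1_def p by (simp_all add: algebra_simps)
  define \<alpha> \<beta> where "\<alpha> = fst (field_of c p)" and "\<beta> = snd (field_of c p)"
  have m: "monomials_dir z \<alpha> $ 1 = cnj z * \<alpha> + z * cnj \<alpha>"
    "monomials_dir z \<alpha> $ 2 = 2 * z * cnj z * \<alpha> + z^2 * cnj \<alpha>"
    "monomials_dir z \<alpha> $ 3 = (cnj z)^2 * \<alpha> + 2 * z * cnj z * cnj \<alpha>"
    "monomials_dir z \<alpha> $ 4 = 3 * z^2 * cnj z * \<alpha> + z^3 * cnj \<alpha>"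
    "monomials_dir z \<alpha> $ 5 = (cnj z)^3 * \<alpha> + 3 * z * (cnj z)^2 * cnj \<alpha>"
    "monomials_dir z \<alpha> $ 6 = 2 * z * (cnj z)^2 * \<alpha> + 2 * z^2 * cnj z * cnj \<alpha>"
    "monomials_dir z \<alpha> $ 7 = 4 * z^3 * cnj z * \<alpha> + z^4 * cnj \<alpha>"
    "monomials_dir z \<alpha> $ 8 = (cnj z)^4 * \<alpha> + 4 * z * (cnj z)^3 * cnj \<alpha>"
    using monomials_dir_slot[of _ _ z \<alpha>] by (simp_all add: exps_def slot_simps flip: slot_simps)
  have "\<forall>k. \<beta> $ k - cnj (\<beta> $ k) = to_w (monomials_dir z \<alpha>) $ k"
    unfolding forall_8 to_w_def vector_8 m
    unfolding \<alpha>_def \<beta>_def p field_of_def case_prod_conv fst_conv snd_conv vector_8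
    by (intro conjI; simp add: cw algebra_simps imaginary_unit_twice power2_eq_square power3_eq_cube power4_eq_xxxx)
  then have "(\<chi> k. \<beta> $ k - cnj (\<beta> $ k)) = to_w (monomials_dir z \<alpha>)" by (simp add: vec_eq_iff)
  then have "to_y \<beta> - conj_swap (to_y \<beta>) = monomials_dir z \<alpha>"
    unfolding to_y_diff_conj_swap to_w_eq_iff .
  then have "(\<alpha>, \<beta>) \<in> tangent_space M1 p"
    using tangent_space_M1_iff[of z w] assms p by simp
  then show ?thesis by (simp add: \<alpha>_def \<beta>_def)
qed

text \<open>\<open>p i j\<close> multiplies the contribution of \<open>[X\<^sub>i, X\<^sub>j]\<close>, so the numerical factors are the structure constants.
  The value is zero for \<open>k = 9\<close> and \<open>k = 10\<close> because no commutator has a component in degree zero.\<close>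

definition bracket_coeffs :: "(nat \<Rightarrow> real) \<Rightarrow> (nat \<Rightarrow> real) \<Rightarrow> nat \<Rightarrow> real"
  where "bracket_coeffs c d k = (let p = (\<lambda>i j. c i * d j - c j * d i) in
    if k = 1 then 2 * p 1 9 + 4 * p 11 12
    else if k = 2 then 4 * p 1 11 + 3 * p 2 9 - p 3 10
    else if k = 3 then 4 * p 1 12 + p 2 10 + 3 * p 3 9
    else if k = 4 then 3 * p 2 11 - 3 * p 3 12 + 4 * p 4 9 - 2 * p 5 10
    else if k = 5 then 3 * p 2 12 + 3 * p 3 11 + 2 * p 4 10 + 4 * p 5 9
    else if k = 6 then 2 * p 2 11 + 2 * p 3 12 + 4 * p 6 9
    else if k = 7 then 4 * p 4 11 - 4 * p 5 12 + 5 * p 7 9 - 3 * p 8 10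
    else if k = 8 then 4 * p 4 12 + 4 * p 5 11 + 3 * p 7 10 + 5 * p 8 9
    else if k = 11 then p 10 12 - p 9 11
    else if k = 12 then - p 9 12 - p 10 11
    else 0)"

definition field_germ :: "(nat \<Rightarrow> real) \<Rightarrow> vf_germ" where "field_germ c = germ (field_of c)"

lemma lie_bracket_field_germ: "lie_bracket (field_germ c) (field_germ d) = field_germ (bracket_coeffs c d)"
proof -
  have "frechet_derivative (field_of c) (at p) = field_deriv c p" for c p
    using frechet_derivative_at[OF has_derivative_field_of] by simp
  then have "lie_bracket (field_germ c) (field_germ d) = germ (\<lambda>p. field_deriv d p (field_of c p) - field_deriv c p (field_of d p))"
    unfolding field_germ_def by transfer simp
  also have "(\<lambda>p. field_deriv d p (field_of c p) - field_deriv c p (field_of d p)) = field_of (bracket_coeffs c d)"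
  proof
    fix p :: cspace
    obtain z w where p: "p = (z, w)" by (cases p)
    show "field_deriv d p (field_of c p) - field_deriv c p (field_of d p) = field_of (bracket_coeffs c d) p"
      unfolding p field_deriv_def field_of_def case_prod_conv bracket_coeffs_def Let_def
      by (simp add: vec_eq_iff forall_8 vector_8 algebra_simps imaginary_unit_twice power2_eq_square power3_eq_cube power4_eq_xxxx)
  qed
  finally show ?thesis by (simp add: field_germ_def)
qed

lemma field_of_cong: "(\<And>i. i \<in> {1..12} \<Longrightarrow> c i = d i) \<Longrightarrow> field_of c = field_of d"
  by (simp add: field_of_def)

lemma field_germ_cong: "(\<And>i. i \<in> {1..12} \<Longrightarrow> c i = d i) \<Longrightarrow> field_germ c = field_germ d"
  unfolding field_germ_def by (metis field_of_cong)

lemma field_germ_add: "field_germ c + field_germ d = field_germ (\<lambda>i. c i + d i)"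
proof -
  have "(\<lambda>p. field_of c p + field_of d p) = field_of (\<lambda>i. c i + d i)"
    by (simp add: fun_eq_iff field_of_def vec_eq_iff forall_8 vector_8 algebra_simps)
  then show ?thesis unfolding field_germ_def by transfer (metis (mono_tags) always_eventually)
qed

lemma field_germ_scale: "r *\<^sub>R field_germ c = field_germ (\<lambda>i. r * c i)"
proof -
  have "(\<lambda>p. r *\<^sub>R field_of c p) = field_of (\<lambda>i. r * c i)"
    unfolding fun_eq_iff field_of_def case_prod_unfold scaleR_Pair scaleR_eq_smult prod.inject
    by (simp add: vec_eq_iff forall_8 vector_8 algebra_simps scaleR_conv_of_real)
  then show ?thesis unfolding field_germ_def by transfer (metis (mono_tags) always_eventually)
qed

lemma field_germ_0: "field_germ (\<lambda>i. 0) = 0"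
  using field_germ_scale[of 0 "\<lambda>i. 0"] by simp

lemma field_germ_sum: "finite I \<Longrightarrow> (\<Sum>k\<in>I. field_germ (f k)) = field_germ (\<lambda>i. \<Sum>k\<in>I. f k i)"
  by (induction I rule: finite_induct) (simp_all add: field_germ_0 field_germ_add)

text \<open>The coefficients are visible at the origin: those of \<open>X\<^sub>1, \<dots>, X\<^sub>8\<close> in the value of \<open>W\<close>, those of \<open>X\<^sub>1\<^sub>1\<close> and \<open>X\<^sub>1\<^sub>2\<close> in
  the value of \<open>Z\<close>, those of \<open>X\<^sub>9\<close> and \<open>X\<^sub>1\<^sub>0\<close> in its \<open>z\<close>-derivative.\<close>

lemma field_germ_eq_0D:
  assumes "field_germ c = 0" "i \<in> {1..12}"
  shows "c i = 0"
proof -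
  have ev: "\<forall>\<^sub>F p in nhds 0. field_of c p = 0" using assms(1) by (simp add: field_germ_def germ_eq_0_iff)
  then have "field_of c 0 = 0" by (rule eventually_nhds_x_imp_x)
  then have f: "fst (field_of c (0, 0)) = 0" "\<forall>k. snd (field_of c (0, 0)) $ k = 0"
    by (simp_all flip: zero_prod_def)
  have c: "c 1 = 0" "c 2 = 0" "c 3 = 0" "c 4 = 0" "c 5 = 0" "c 6 = 0" "c 7 = 0" "c 8 = 0"
    using f(2) unfolding forall_8 by (simp_all add: field_of_def vector_8)
  have c': "c 11 = 0" "c 12 = 0"
    using f(1) by (simp_all add: field_of_def complex_eq_iff)
  have "field_deriv c 0 (1, 0) = 0"
  proof -
    have "(field_of c has_derivative (\<lambda>h. 0)) (at 0)"
      by (rule has_derivative_transform_eventually[of "\<lambda>p. 0"])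
        (use ev in \<open>auto simp: eventually_at_filter elim: eventually_mono dest: eventually_nhds_x_imp_x\<close>)
    then have "field_deriv c 0 = (\<lambda>h. 0)" using has_derivative_field_of has_derivative_unique by blast
    then show ?thesis by simp
  qed
  then have "c 9 = 0" "c 10 = 0"
    by (simp_all add: field_deriv_def case_prod_unfold zero_prod_def complex_eq_iff)
  moreover have "i = 1 \<or> i = 2 \<or> i = 3 \<or> i = 4 \<or> i = 5 \<or> i = 6 \<or> i = 7 \<or> i = 8 \<or> i = 9 \<or> i = 10 \<or> i = 11 \<or> i = 12"
    using assms(2) by (simp, presburger)
  ultimately show ?thesis using c c' by auto
qed

section \<open>The Lie algebra and its grading\<close>

lemma one_to_twelve_cases:
  assumes "i \<in> {1..12::nat}"
  obtains "i = 1" | "i = 2" | "i = 3" | "i = 4" | "i = 5" | "i = 6" | "i = 7" | "i = 8" | "i = 9" | "i = 10"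
    | "i = 11" | "i = 12"
proof -
  have "i = 1 \<or> i = 2 \<or> i = 3 \<or> i = 4 \<or> i = 5 \<or> i = 6 \<or> i = 7 \<or> i = 8 \<or> i = 9 \<or> i = 10 \<or> i = 11 \<or> i = 12"
    using assms by (simp, presburger)
  then show thesis using that by blast
qed

lemma XF_eq_field_germ:
  assumes "i \<in> {1..12}"
  shows "XF i = field_germ (\<lambda>j. if j = i then 1 else 0)"
proof -
  have dw: "dw l = field_germ c" if "\<And>z w. field_of c (z, w) = (0, axis l 1)" for l c
    unfolding dw_def field_germ_def using that by (intro arg_cong[of _ _ germ]) auto
  have XF8: "XF i = dw (of_nat i)" if "i \<le> 8" for i using that by (simp add: XF_def)
  show ?thesis
  proof (cases "i \<le> 8")
    case True
    show ?thesis
      unfolding XF8[OF True]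
    proof (rule dw)
      fix z w
      show "field_of (\<lambda>j. if j = i then 1 else 0) (z, w) = (0, axis (of_nat i) 1)"
        using assms by (cases rule: one_to_twelve_cases)
          (use True in \<open>simp_all add: field_of_def vec_eq_iff forall_8 vector_8 axis_def\<close>)
    qed
  next
    case False
    then consider "i = 9" | "i = 10" | "i = 11" | "i = 12" using assms by force
    then show ?thesis
      by cases (simp_all add: XF_def field_germ_def field_of_def case_prod_unfold)
  qed
qed

lemma field_germ_eq_iff: "field_germ c = field_germ d \<longleftrightarrow> (\<forall>i\<in>{1..12}. c i = d i)"
proof
  assume "field_germ c = field_germ d"
  have "field_germ (\<lambda>i. c i + (- 1) * d i) = field_germ c + (- 1) *\<^sub>R field_germ d"
    unfolding field_germ_scale field_germ_add ..
  also have "\<dots> = 0" using \<open>field_germ c = field_germ d\<close> by simp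
  finally have "field_germ (\<lambda>i. c i + (- 1) * d i) = 0" .
  from field_germ_eq_0D[OF this] show "\<forall>i\<in>{1..12}. c i = d i" by auto
qed (auto intro: field_germ_cong)

lemma field_germ_eq_sum: "field_germ c = (\<Sum>i=1..12. c i *\<^sub>R XF i)"
proof -
  have "(\<Sum>i=1..12. c i *\<^sub>R XF i) = (\<Sum>i\<in>{1..12}. field_germ (\<lambda>j. c i * (if j = i then 1 else 0)))"
    by (rule sum.cong) (simp_all add: XF_eq_field_germ field_germ_scale)
  also have "\<dots> = field_germ (\<lambda>j. \<Sum>i\<in>{1..12}. c i * (if j = i then 1 else 0))"
    by (rule field_germ_sum) simp
  also have "\<dots> = field_germ c" by (rule field_germ_cong) (simp add: if_distrib[of "(*) _"] cong: if_cong)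
  finally show ?thesis ..
qed

lemma span_XF:
  assumes "S \<subseteq> {1..12}"
  shows "span (XF ` S) = field_germ ` {c. \<forall>i\<in>{1..12}. i \<notin> S \<longrightarrow> c i = 0}"
proof
  let ?T = "field_germ ` {c. \<forall>i\<in>{1..12}. i \<notin> S \<longrightarrow> c i = 0}"
  have "subspace ?T"
    unfolding subspace_def
  proof (intro conjI ballI allI)
    show "0 \<in> ?T" using field_germ_0 by (intro image_eqI[of _ _ "\<lambda>i. 0"]) auto
    show "x + y \<in> ?T" if "x \<in> ?T" "y \<in> ?T" for x y
      using that by (auto simp: field_germ_add)
    show "r *\<^sub>R x \<in> ?T" if "x \<in> ?T" for r x
      using that by (auto simp: field_germ_scale)
  qed
  moreover have "XF ` S \<subseteq> ?T"
    using assms by (auto simp: XF_eq_field_germ subset_iff)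
  ultimately show "span (XF ` S) \<subseteq> ?T" by (rule span_minimal[rotated])
  show "?T \<subseteq> span (XF ` S)"
  proof clarify
    fix c assume c: "\<forall>i\<in>{1..12}. i \<notin> S \<longrightarrow> c i = (0::real)"
    have "c i *\<^sub>R XF i \<in> span (XF ` S)" if "i \<in> {1..12}" for i
      using c that by (cases "i \<in> S") (auto intro: span_scale span_base span_zero)
    then show "field_germ c \<in> span (XF ` S)" unfolding field_germ_eq_sum by (intro span_sum)
  qed
qed

lemma tangent_space_diff:
  assumes "p \<in> M1" "u \<in> tangent_space M1 p" "v \<in> tangent_space M1 p"
  shows "u - v \<in> tangent_space M1 p"
proof -
  obtain z w where p: "p = (z, w)" by (cases p)
  obtain \<alpha> \<beta> where u: "u = (\<alpha>, \<beta>)" by (cases u)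
  obtain \<alpha>' \<beta>' where v: "v = (\<alpha>', \<beta>')" by (cases v)
  have "monomials_dir z (\<alpha> - \<alpha>') = monomials_dir z \<alpha> - monomials_dir z \<alpha>'"
    unfolding vec_eq_slots by (auto simp: monomials_dir_slot algebra_simps)
  moreover have "to_y (\<beta> - \<beta>') - conj_swap (to_y (\<beta> - \<beta>')) =
      (to_y \<beta> - conj_swap (to_y \<beta>)) - (to_y \<beta>' - conj_swap (to_y \<beta>'))"
    by (simp add: linear_diff[OF bounded_linear.linear[OF bounded_linear_to_y]] linear_diff[OF linear_conj_swap])
  ultimately show ?thesis
    using assms(2,3) tangent_space_M1_iff[OF assms(1)[unfolded p]] unfolding p u v by simp
qed

text \<open>A given automorphism is compared with the combination that has the same value at the origin and the
  same \<open>z\<close>-derivative of \<open>Z\<close> there; their difference vanishes by rigidity.\<close>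

lemma aut_CR_M1: "aut_CR M1 = range field_germ"
proof
  show "range field_germ \<subseteq> aut_CR M1"
    unfolding aut_CR_def field_germ_def using holomorphic_near_field_of field_of_tangent by blast
  show "aut_CR M1 \<subseteq> range field_germ"
  proof
    fix X assume "X \<in> aut_CR M1"
    then obtain F U where X: "X = germ F" and F: "holomorphic_near F U"
      and T: "\<And>p. p \<in> M1 \<Longrightarrow> p \<in> U \<Longrightarrow> F p \<in> tangent_space M1 p"
      unfolding aut_CR_def by blast
    have U: "0 \<in> U" using F by (simp add: holomorphic_near_def)
    obtain D where D: "(F has_derivative D) (at 0)" using F U unfolding holomorphic_near_def by blast
    obtain \<alpha> \<beta> where F0: "F 0 = (\<alpha>, \<beta>)" by (cases "F 0")
    have "0 \<in> M1" by (simp add: M1_def zero_prod_def)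
    from T[OF this U] have "(\<alpha>, \<beta>) \<in> tangent_space M1 (0, 0)"
      unfolding F0 unfolding zero_prod_def .
    then have "to_y \<beta> - conj_swap (to_y \<beta>) = monomials_dir 0 \<alpha>"
      using tangent_space_M1_iff[of 0 0] \<open>0 \<in> M1\<close> by (simp add: zero_prod_def)
    also have "monomials_dir 0 \<alpha> = 0"
      unfolding vec_eq_slots by (auto simp: monomials_dir_slot) (auto simp: exps_def)
    finally have "(\<chi> k. \<beta> $ k - cnj (\<beta> $ k)) = to_w 0"
      unfolding to_y_diff_conj_swap to_w_eq_iff .
    \<comment> \<open>At the origin all monomials are stationary, so the \<open>w\<close>-component of a tangent vector is real there.\<close>
    then have real: "\<beta> $ k = of_real (Re (\<beta> $ k))" for k
      using linear_0[OF bounded_linear.linear[OF bounded_linear_to_w]]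
      by (simp add: vec_eq_iff complex_eq_iff)
    define \<kappa> where "\<kappa> = fst (D (1, 0))"
    define c :: "nat \<Rightarrow> real" where "c i = (if i \<le> 8 then Re (\<beta> $ of_nat i) else if i = 9 then Re \<kappa>
      else if i = 10 then Im \<kappa> else if i = 11 then Re \<alpha> else Im \<alpha>)" for i
    define H where "H p = F p - field_of c p" for p
    have Dc: "(H has_derivative (\<lambda>v. D' v - field_deriv c p v)) (at p)" if "(F has_derivative D') (at p)" for D' p
      unfolding H_def by (intro has_derivative_diff that has_derivative_field_of)
    have cs: "cscale a u - cscale a v = cscale a (u - v)" for a u v
      by (simp add: cscale_def vec_eq_iff algebra_simps)
    have "holomorphic_near H U"
      using F unfolding holomorphic_near_def
    proof safe
      fix z w assume *: "\<forall>p\<in>U. \<exists>D. (F has_derivative D) (at p) \<and> (\<forall>c v. D (cscale c v) = cscale c (D v))" "(z, w) \<in> U"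
      then obtain D' where D': "(F has_derivative D') (at (z, w))" "\<forall>c v. D' (cscale c v) = cscale c (D' v)" by blast
      show "\<exists>D. (H has_derivative D) (at (z, w)) \<and> (\<forall>c v. D (cscale c v) = cscale c (D v))"
        by (rule exI, rule conjI, rule Dc[OF D'(1)]) (simp add: D'(2) field_deriv_cscale cs)
    qed
    moreover have "H p \<in> tangent_space M1 p" if "p \<in> M1" "p \<in> U" for p
      unfolding H_def by (intro tangent_space_diff that T field_of_tangent)
    moreover have "H 0 = 0"
    proof -
      have "field_of c 0 = (\<alpha>, \<beta>)"
        unfolding zero_prod_def field_of_def case_prod_conv prod.inject
        by (simp add: c_def vec_eq_iff forall_8 vector_8 real[symmetric] complex_eq_iff)
      then show ?thesis by (simp add: H_def F0)
    qed
    moreover have "fst (frechet_derivative H (at 0) (1, 0)) = 0"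
    proof -
      have "frechet_derivative H (at 0) = (\<lambda>v. D v - field_deriv c 0 v)"
        using frechet_derivative_at[OF Dc[OF D]] by simp
      moreover have "fst (field_deriv c 0 (1, 0)) = \<kappa>"
        by (simp add: field_deriv_def zero_prod_def c_def complex_eq_iff)
      ultimately show ?thesis by (simp add: \<kappa>_def)
    qed
    ultimately have "germ H = 0" by (rule tangent_field_zero_of_initial_data)
    then have "germ F = field_germ c" unfolding field_germ_def germ_eq_iff germ_eq_0_iff H_def by simp
    then show "X \<in> range field_germ" using X by simp
  qed
qed

definition deg :: "nat \<Rightarrow> int"
  where "deg i = (if i = 1 then -2 else if i \<le> 3 then -3 else if i \<le> 6 then -4 else if i \<le> 8 then -5
    else if i \<le> 10 then 0 else -1)"

lemma gr_eq_degree: "gr k = field_germ ` {c. \<forall>i\<in>{1..12}. deg i \<noteq> k \<longrightarrow> c i = 0}"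
proof -
  have *: "span (XF ` S) = field_germ ` {c. \<forall>i\<in>{1..12}. deg i \<noteq> k \<longrightarrow> c i = 0}" if "S = {i \<in> {1..12}. deg i = k}" for S
  proof -
    have e: "{c. \<forall>i\<in>{1..12}. i \<notin> S \<longrightarrow> c i = 0} = {c :: nat \<Rightarrow> real. \<forall>i\<in>{1..12}. deg i \<noteq> k \<longrightarrow> c i = 0}"
      using that by auto
    have "S \<subseteq> {1..12}" using that by auto
    from span_XF[OF this] show ?thesis unfolding e .
  qed
  have r: "{1..12::nat} = {1,2,3,4,5,6,7,8,9,10,11,12}"
    by (rule equalityI, rule subsetI, erule one_to_twelve_cases) auto
  consider "k = -5" | "k = -4" | "k = -3" | "k = -2" | "k = -1" | "k = 0" | "k < -5 \<or> k > 0" by linarith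
  then show ?thesis
  proof cases
    case 7
    then have "{i \<in> {1..12}. deg i = k} = {}" unfolding r by (auto simp: deg_def)
    then have "span (XF ` {}) = field_germ ` {c. \<forall>i\<in>{1..12}. deg i \<noteq> k \<longrightarrow> c i = 0}" by (intro *) auto
    then show ?thesis using 7 by (auto simp: gr_def)
  next
    case 1
    have "span (XF ` {7, 8}) = field_germ ` {c. \<forall>i\<in>{1..12}. deg i \<noteq> k \<longrightarrow> c i = 0}"
      by (rule *) (auto simp: r deg_def 1)
    then show ?thesis using 1 by (simp add: gr_def)
  next
    case 2
    have "span (XF ` {4, 5, 6}) = field_germ ` {c. \<forall>i\<in>{1..12}. deg i \<noteq> k \<longrightarrow> c i = 0}"
      by (rule *) (auto simp: r deg_def 2)
    then show ?thesis using 2 by (simp add: gr_def)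
  next
    case 3
    have "span (XF ` {2, 3}) = field_germ ` {c. \<forall>i\<in>{1..12}. deg i \<noteq> k \<longrightarrow> c i = 0}"
      by (rule *) (auto simp: r deg_def 3)
    then show ?thesis using 3 by (simp add: gr_def)
  next
    case 4
    have "span (XF ` {1}) = field_germ ` {c. \<forall>i\<in>{1..12}. deg i \<noteq> k \<longrightarrow> c i = 0}"
      by (rule *) (auto simp: r deg_def 4)
    then show ?thesis using 4 by (simp add: gr_def)
  next
    case 5
    have "span (XF ` {11, 12}) = field_germ ` {c. \<forall>i\<in>{1..12}. deg i \<noteq> k \<longrightarrow> c i = 0}"
      by (rule *) (auto simp: r deg_def 5)
    then show ?thesis using 5 by (simp add: gr_def)
  next
    case 6
    have "span (XF ` {9, 10}) = field_germ ` {c. \<forall>i\<in>{1..12}. deg i \<noteq> k \<longrightarrow> c i = 0}"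
      by (rule *) (auto simp: r deg_def 6)
    then show ?thesis using 6 by (simp add: gr_def)
  qed
qed

lemma bracket_coeffs_simps:
  "bracket_coeffs c d 1 = 2 * (c 1 * d 9 - c 9 * d 1) + 4 * (c 11 * d 12 - c 12 * d 11)"
  "bracket_coeffs c d 2 = 4 * (c 1 * d 11 - c 11 * d 1) + 3 * (c 2 * d 9 - c 9 * d 2) - (c 3 * d 10 - c 10 * d 3)"
  "bracket_coeffs c d 3 = 4 * (c 1 * d 12 - c 12 * d 1) + (c 2 * d 10 - c 10 * d 2) + 3 * (c 3 * d 9 - c 9 * d 3)"
  "bracket_coeffs c d 4 = 3 * (c 2 * d 11 - c 11 * d 2) - 3 * (c 3 * d 12 - c 12 * d 3) + 4 * (c 4 * d 9 - c 9 * d 4) - 2 * (c 5 * d 10 - c 10 * d 5)"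
  "bracket_coeffs c d 5 = 3 * (c 2 * d 12 - c 12 * d 2) + 3 * (c 3 * d 11 - c 11 * d 3) + 2 * (c 4 * d 10 - c 10 * d 4) + 4 * (c 5 * d 9 - c 9 * d 5)"
  "bracket_coeffs c d 6 = 2 * (c 2 * d 11 - c 11 * d 2) + 2 * (c 3 * d 12 - c 12 * d 3) + 4 * (c 6 * d 9 - c 9 * d 6)"
  "bracket_coeffs c d 7 = 4 * (c 4 * d 11 - c 11 * d 4) - 4 * (c 5 * d 12 - c 12 * d 5) + 5 * (c 7 * d 9 - c 9 * d 7) - 3 * (c 8 * d 10 - c 10 * d 8)"
  "bracket_coeffs c d 8 = 4 * (c 4 * d 12 - c 12 * d 4) + 4 * (c 5 * d 11 - c 11 * d 5) + 3 * (c 7 * d 10 - c 10 * d 7) + 5 * (c 8 * d 9 - c 9 * d 8)"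
  "bracket_coeffs c d 9 = 0"
  "bracket_coeffs c d 10 = 0"
  "bracket_coeffs c d 11 = (c 10 * d 12 - c 12 * d 10) - (c 9 * d 11 - c 11 * d 9)"
  "bracket_coeffs c d 12 = - (c 9 * d 12 - c 12 * d 9) - (c 10 * d 11 - c 11 * d 10)"
  by (simp_all add: bracket_coeffs_def)

lemma bracket_coeffs_translations:
  assumes "\<And>i. i \<in> {9..12} \<Longrightarrow> c i = 0" "\<And>i. i \<in> {9..12} \<Longrightarrow> d i = 0"
  shows "bracket_coeffs c d k = 0"
  using assms by (simp add: bracket_coeffs_def)

lemma real_lie_algebra_aut: "real_lie_algebra lie_bracket (range field_germ)"
  unfolding real_lie_algebra_def
proof (intro conjI ballI allI)
  show "subspace (range field_germ)"
    using span_XF[of "{1..12}"] subspace_span[of "XF ` {1..12}"] by (simp add: full_SetCompr_eq flip: image_def)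
  fix x y u assume "x \<in> range field_germ" "y \<in> range field_germ" "u \<in> range field_germ"
  then obtain c d e where x: "x = field_germ c" and y: "y = field_germ d" and u: "u = field_germ e" by blast
  show "lie_bracket x y \<in> range field_germ" by (simp add: x y lie_bracket_field_germ)
  show "lie_bracket x x = 0"
    unfolding x lie_bracket_field_germ field_germ_0[symmetric] by (intro field_germ_cong) (simp add: bracket_coeffs_def Let_def)
  show "lie_bracket (a *\<^sub>R x + b *\<^sub>R y) u = a *\<^sub>R lie_bracket x u + b *\<^sub>R lie_bracket y u" for a b
    unfolding x y u lie_bracket_field_germ field_germ_scale field_germ_add
    by (intro field_germ_cong) (simp add: bracket_coeffs_def Let_def algebra_simps)
  show "lie_bracket u (a *\<^sub>R x + b *\<^sub>R y) = a *\<^sub>R lie_bracket u x + b *\<^sub>R lie_bracket u y" for a b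
    unfolding x y u lie_bracket_field_germ field_germ_scale field_germ_add
    by (intro field_germ_cong) (simp add: bracket_coeffs_def Let_def algebra_simps)
  show "lie_bracket x (lie_bracket y u) + lie_bracket y (lie_bracket u x) + lie_bracket u (lie_bracket x y) = 0"
    unfolding x y u lie_bracket_field_germ field_germ_add field_germ_0[symmetric]
    by (intro field_germ_cong, erule one_to_twelve_cases; hypsubst_thin; simp only: bracket_coeffs_simps; algebra)
qed

lemma deg_range: "i \<in> {1..12} \<Longrightarrow> deg i \<in> {-5..0}"
  by (simp add: deg_def)

text \<open>Every product \<open>c i * d j\<close> in the coefficient number \<open>k\<close> satisfies \<open>deg i + deg j = deg k\<close>.\<close>

lemma bracket_coeffs_deg:
  assumes c: "\<forall>i\<in>{1..12}. deg i \<noteq> k \<longrightarrow> c i = 0" and d: "\<forall>i\<in>{1..12}. deg i \<noteq> l \<longrightarrow> d i = 0"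
    and i: "i \<in> {1..12}" "deg i \<noteq> k + l"
  shows "bracket_coeffs c d i = 0"
proof -
  have cd: "c a * d b = 0" if "a \<in> {1..12}" "b \<in> {1..12}" "deg a + deg b \<noteq> k + l" for a b
    using bspec[OF c that(1)] bspec[OF d that(2)] that(3) by (cases "deg a = k") auto
  show ?thesis
    using i(1) by (cases rule: one_to_twelve_cases)
      (use i(2) in \<open>simp_all add: bracket_coeffs_def Let_def cd deg_def del: mult_eq_0_iff\<close>)
qed

lemma graded_lie_algebra_aut: "graded_lie_algebra lie_bracket (range field_germ) (-5) 0 gr"
  unfolding graded_lie_algebra_def
proof (intro conjI allI ballI impI)
  show "real_lie_algebra lie_bracket (range field_germ)" by (rule real_lie_algebra_aut)
  show "gr k \<subseteq> range field_germ" for k unfolding gr_eq_degree by auto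
  show "subspace (gr k)" for k
    unfolding gr_def by (auto simp: subspace_single_0)
  show "gr k = {0}" if "k \<notin> {-5..0}" for k
    using that by (auto simp: gr_def)
  show "lie_bracket x y \<in> gr (k + l)" if "x \<in> gr k" "y \<in> gr l" for k l x y
    using that bracket_coeffs_deg unfolding gr_eq_degree by (auto simp: lie_bracket_field_germ)
  fix x assume "x \<in> range field_germ"
  then obtain c where x: "x = field_germ c" by blast
  define f where "f = (\<lambda>k\<in>{-5..0}. field_germ (\<lambda>i. if deg i = k then c i else 0))"
  show "\<exists>!f. f \<in> (\<Pi>\<^sub>E k\<in>{-5..0}. gr k) \<and> x = (\<Sum>k=-5..0. f k)"
  proof (rule ex1I[of _ f], intro conjI)
    show "f \<in> (\<Pi>\<^sub>E k\<in>{-5..0}. gr k)" unfolding f_def gr_eq_degree by auto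
    have "(\<Sum>k=-5..0. f k) = (\<Sum>k\<in>{-5..0}. field_germ (\<lambda>i. if deg i = k then c i else 0))"
      by (rule sum.cong) (simp_all add: f_def)
    also have "\<dots> = field_germ (\<lambda>i. \<Sum>k\<in>{-5..0}. if deg i = k then c i else 0)" by (rule field_germ_sum) simp
    also have "\<dots> = x" unfolding x by (rule field_germ_cong) (use deg_range in simp)
    finally show "x = (\<Sum>k=-5..0. f k)" ..
  next
    fix h assume h: "h \<in> (\<Pi>\<^sub>E k\<in>{-5..0}. gr k) \<and> x = (\<Sum>k=-5..0. h k)"
    then have "\<forall>k\<in>{-5..0}. \<exists>d. h k = field_germ d \<and> (\<forall>i\<in>{1..12}. deg i \<noteq> k \<longrightarrow> d i = 0)"
      unfolding gr_eq_degree by (auto simp: PiE_def Pi_def image_iff)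
    then obtain d where d: "\<And>k. k \<in> {-5..0} \<Longrightarrow> h k = field_germ (d k)"
      and d0: "\<And>k i. k \<in> {-5..0} \<Longrightarrow> i \<in> {1..12} \<Longrightarrow> deg i \<noteq> k \<Longrightarrow> d k i = 0"
      by metis
    have "field_germ c = (\<Sum>k\<in>{-5..0}. field_germ (d k))" using h x d by simp
    also have "\<dots> = field_germ (\<lambda>i. \<Sum>k\<in>{-5..0}. d k i)" by (rule field_germ_sum) simp
    finally have "field_germ c = field_germ (\<lambda>i. \<Sum>k\<in>{-5..0}. d k i)" .
    note eq = bspec[OF this[unfolded field_germ_eq_iff]]
    have cd: "c i = d (deg i) i" if i: "i \<in> {1..12}" for i
    proof -
      have "(\<Sum>k\<in>{-5..0}. d k i) = (\<Sum>k\<in>{-5..0}. if k = deg i then d (deg i) i else 0)"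
        by (rule sum.cong) (use d0 i in auto)
      then show ?thesis using eq[OF i] deg_range[OF i] by simp
    qed
    show "h = f"
    proof
      fix k
      show "h k = f k"
      proof (cases "k \<in> {-5..0}")
        case True
        have "field_germ (d k) = field_germ (\<lambda>i. if deg i = k then c i else 0)"
        proof (rule field_germ_cong)
          fix i assume i: "i \<in> {1..12::nat}"
          show "d k i = (if deg i = k then c i else 0)"
            using cd[OF i] d0[OF True i] by simp
        qed
        then show ?thesis using d[OF True] True by (simp add: f_def)
      next
        case False
        show ?thesis
          unfolding f_def restrict_apply if_not_P[OF False] by (rule PiE_arb[OF conjunct1[OF h] False])
      qed
    qed
  qed
qed

lemma inj_XF: "inj_on XF {1..12}"
proof (rule inj_onI)
  fix i j assume i: "i \<in> {1..12::nat}" and j: "j \<in> {1..12::nat}" and "XF i = XF j"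
  then have "field_germ (\<lambda>k. if k = i then 1 else 0) = field_germ (\<lambda>k. if k = j then 1 else 0)" using XF_eq_field_germ by simp
  from bspec[OF this[unfolded field_germ_eq_iff] i] show "i = j" by (simp split: if_splits)
qed

lemma independent_XF: "independent (XF ` {1..12})"
proof (rule independent_if_scalars_zero)
  fix f x assume f: "(\<Sum>x\<in>XF ` {1..12}. f x *\<^sub>R x) = 0" and x: "x \<in> XF ` {1..12}"
  have "field_germ (\<lambda>i. f (XF i)) = 0"
    using f unfolding field_germ_eq_sum sum.reindex[OF inj_XF] by simp
  then show "f x = 0" using field_germ_eq_0D x by blast
qed simp

lemma field_germ_uminus: "- field_germ c = field_germ (\<lambda>i. - c i)"
  using field_germ_scale[of "- 1" c] by simp

lemma bracket_table:
  "lie_bracket (XF 1) (XF 9) = 2 *\<^sub>R XF 1"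
  "lie_bracket (XF 1) (XF 10) = 0"
  "lie_bracket (XF 1) (XF 11) = 4 *\<^sub>R XF 2"
  "lie_bracket (XF 1) (XF 12) = 4 *\<^sub>R XF 3"
  "lie_bracket (XF 2) (XF 9) = 3 *\<^sub>R XF 2"
  "lie_bracket (XF 2) (XF 10) = XF 3"
  "lie_bracket (XF 2) (XF 11) = 3 *\<^sub>R XF 4 + 2 *\<^sub>R XF 6"
  "lie_bracket (XF 2) (XF 12) = 3 *\<^sub>R XF 5"
  "lie_bracket (XF 3) (XF 9) = 3 *\<^sub>R XF 3"
  "lie_bracket (XF 3) (XF 10) = - XF 2"
  "lie_bracket (XF 3) (XF 11) = 3 *\<^sub>R XF 5"
  "lie_bracket (XF 3) (XF 12) = (- 3) *\<^sub>R XF 4 + 2 *\<^sub>R XF 6"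
  "lie_bracket (XF 4) (XF 9) = 4 *\<^sub>R XF 4"
  "lie_bracket (XF 4) (XF 10) = 2 *\<^sub>R XF 5"
  "lie_bracket (XF 4) (XF 11) = 4 *\<^sub>R XF 7"
  "lie_bracket (XF 4) (XF 12) = 4 *\<^sub>R XF 8"
  "lie_bracket (XF 5) (XF 9) = 4 *\<^sub>R XF 5"
  "lie_bracket (XF 5) (XF 10) = (- 2) *\<^sub>R XF 4"
  "lie_bracket (XF 5) (XF 11) = 4 *\<^sub>R XF 8"
  "lie_bracket (XF 5) (XF 12) = (- 4) *\<^sub>R XF 7"
  "lie_bracket (XF 6) (XF 9) = 4 *\<^sub>R XF 6"
  "lie_bracket (XF 6) (XF 10) = 0"
  "lie_bracket (XF 6) (XF 11) = 0"
  "lie_bracket (XF 6) (XF 12) = 0"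
  "lie_bracket (XF 7) (XF 9) = 5 *\<^sub>R XF 7"
  "lie_bracket (XF 7) (XF 10) = 3 *\<^sub>R XF 8"
  "lie_bracket (XF 7) (XF 11) = 0"
  "lie_bracket (XF 7) (XF 12) = 0"
  "lie_bracket (XF 8) (XF 9) = 5 *\<^sub>R XF 8"
  "lie_bracket (XF 8) (XF 10) = (- 3) *\<^sub>R XF 7"
  "lie_bracket (XF 8) (XF 11) = 0"
  "lie_bracket (XF 8) (XF 12) = 0"
  "lie_bracket (XF 9) (XF 10) = 0"
  "lie_bracket (XF 9) (XF 11) = - XF 11"
  "lie_bracket (XF 9) (XF 12) = - XF 12"
  "lie_bracket (XF 10) (XF 11) = - XF 12"
  "lie_bracket (XF 10) (XF 12) = XF 11"
  "lie_bracket (XF 11) (XF 12) = 4 *\<^sub>R XF 1"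
  by (simp_all add: XF_eq_field_germ lie_bracket_field_germ field_germ_scale field_germ_add field_germ_uminus flip: field_germ_0;
      rule field_germ_cong, erule one_to_twelve_cases; simp add: bracket_coeffs_def)+

theorem theorem5p1:
  shows "real_lie_algebra lie_bracket (aut_CR M1) \<and>
    dim (aut_CR M1) = 12 \<and>
    inj_on XF {1..12} \<and>
    independent (XF ` {1..12}) \<and>
    aut_CR M1 = span (XF ` {1..12}) \<and>
    graded_lie_algebra lie_bracket (aut_CR M1) (-5) 0 gr \<and>
    (\<forall>i\<in>{1..8}. \<forall>j\<in>{1..8}. lie_bracket (XF i) (XF j) = 0) \<and>
    lie_bracket (XF 1) (XF 9) = 2 *\<^sub>R XF 1 \<and>
    lie_bracket (XF 1) (XF 10) = 0 \<and>
    lie_bracket (XF 1) (XF 11) = 4 *\<^sub>R XF 2 \<and>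
    lie_bracket (XF 1) (XF 12) = 4 *\<^sub>R XF 3 \<and>
    lie_bracket (XF 2) (XF 9) = 3 *\<^sub>R XF 2 \<and>
    lie_bracket (XF 2) (XF 10) = XF 3 \<and>
    lie_bracket (XF 2) (XF 11) = 3 *\<^sub>R XF 4 + 2 *\<^sub>R XF 6 \<and>
    lie_bracket (XF 2) (XF 12) = 3 *\<^sub>R XF 5 \<and>
    lie_bracket (XF 3) (XF 9) = 3 *\<^sub>R XF 3 \<and>
    lie_bracket (XF 3) (XF 10) = - XF 2 \<and>
    lie_bracket (XF 3) (XF 11) = 3 *\<^sub>R XF 5 \<and>
    lie_bracket (XF 3) (XF 12) = (- 3) *\<^sub>R XF 4 + 2 *\<^sub>R XF 6 \<and>
    lie_bracket (XF 4) (XF 9) = 4 *\<^sub>R XF 4 \<and>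
    lie_bracket (XF 4) (XF 10) = 2 *\<^sub>R XF 5 \<and>
    lie_bracket (XF 4) (XF 11) = 4 *\<^sub>R XF 7 \<and>
    lie_bracket (XF 4) (XF 12) = 4 *\<^sub>R XF 8 \<and>
    lie_bracket (XF 5) (XF 9) = 4 *\<^sub>R XF 5 \<and>
    lie_bracket (XF 5) (XF 10) = (- 2) *\<^sub>R XF 4 \<and>
    lie_bracket (XF 5) (XF 11) = 4 *\<^sub>R XF 8 \<and>
    lie_bracket (XF 5) (XF 12) = (- 4) *\<^sub>R XF 7 \<and>
    lie_bracket (XF 6) (XF 9) = 4 *\<^sub>R XF 6 \<and>
    lie_bracket (XF 6) (XF 10) = 0 \<and>
    lie_bracket (XF 6) (XF 11) = 0 \<and>
    lie_bracket (XF 6) (XF 12) = 0 \<and>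
    lie_bracket (XF 7) (XF 9) = 5 *\<^sub>R XF 7 \<and>
    lie_bracket (XF 7) (XF 10) = 3 *\<^sub>R XF 8 \<and>
    lie_bracket (XF 7) (XF 11) = 0 \<and>
    lie_bracket (XF 7) (XF 12) = 0 \<and>
    lie_bracket (XF 8) (XF 9) = 5 *\<^sub>R XF 8 \<and>
    lie_bracket (XF 8) (XF 10) = (- 3) *\<^sub>R XF 7 \<and>
    lie_bracket (XF 8) (XF 11) = 0 \<and>
    lie_bracket (XF 8) (XF 12) = 0 \<and>
    lie_bracket (XF 9) (XF 10) = 0 \<and>
    lie_bracket (XF 9) (XF 11) = - XF 11 \<and>
    lie_bracket (XF 9) (XF 12) = - XF 12 \<and>
    lie_bracket (XF 10) (XF 11) = - XF 12 \<and>
    lie_bracket (XF 10) (XF 12) = XF 11 \<and>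
    lie_bracket (XF 11) (XF 12) = 4 *\<^sub>R XF 1"
proof -
  have aut: "aut_CR M1 = span (XF ` {1..12})"
    using span_XF[of "{1..12}"] aut_CR_M1 by (simp add: full_SetCompr_eq flip: image_def)
  have "dim (aut_CR M1) = 12"
    unfolding aut using dim_span_eq_card_independent[OF independent_XF] card_image[OF inj_XF] by simp
  moreover have "\<forall>i\<in>{1..8}. \<forall>j\<in>{1..8}. lie_bracket (XF i) (XF j) = 0"
  proof (intro ballI)
    fix i j assume i: "i \<in> {1..8::nat}" and j: "j \<in> {1..8::nat}"
    then have ij: "i \<in> {1..12}" "j \<in> {1..12}" by auto
    show "lie_bracket (XF i) (XF j) = 0"
      unfolding XF_eq_field_germ[OF ij(1)] XF_eq_field_germ[OF ij(2)] lie_bracket_field_germ field_germ_0[symmetric]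
      by (intro field_germ_cong bracket_coeffs_translations) (use i j in auto)
  qed
  ultimately show ?thesis
    using real_lie_algebra_aut graded_lie_algebra_aut inj_XF independent_XF aut
    unfolding aut_CR_M1 by (intro conjI bracket_table) assumption+
qed

end
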